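(* Let $n,p,\theta$ be positive integers, and let $q_m^{(\alpha)}$ ($1\le m\le n$) and $e_m^{(\alpha)}$ ($0\le m\le n$), $\alpha=0,1,2,\dots$, be real $p\times p$ matrices generated by the generalized block qd-algorithm (see context), with associated $np\times np$ matrices $\mathscr{L}_n^{(\alpha)}$, $\mathscr{R}_n^{(\alpha)}$ and $\mathscr{J}_n^{(\alpha)}=\mathscr{L}_n^{(\alpha)}\mathscr{L}_n^{(\alpha+1)}\cdots\mathscr{L}_n^{(\alpha+\theta-1)}\mathscr{R}_n^{(\alpha)}$. Suppose $\mathscr{J}_n^{(0)}$ has distinct eigenvalues $\lambda_1,\dots,\lambda_s$, $s<np$, where $\lambda_i$ has multiplicity $\eta_i$, $\sum_{i=1}^s\eta_i=np$, ordered so that $|\lambda_i|>|\lambda_{i+1}|$. Let $D_n=\mathrm{diag}(\lambda_1,\dots,\lambda_1,\dots,\lambda_s,\dots,\lambda_s)$ (each $\lambda_i$ repeated $\eta_i$ times) and let $X_n$ be the corresponding eigenvector matrix, i.e. an invertible matrix with $\mathscr{J}_n^{(0)}=X_nD_nX_n^{-1}$. Suppose the $n-1$ leading principal block minors of $X_n$, of $X_n^{-1}$ and of $X_n\tilde L$ are nonzero, where $\tilde L$ is the matrix defined in the context from the block LU decomposition of $X_n^{-1}$. Then, as $\alpha\to\infty$, the sequences $q_m^{(\theta\alpha)}$ ($m=1,\dots,n$) converge and $$\lim_{\alpha\to\infty}\mathscr{J}_n^{(\theta\alpha)}=\begin{pmatrix} q_1^{\infty}&\mathbb{I}_p&&\\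 &\ddots&\ddots&\\ &&q_{n-1}^{\infty}&\mathbb{I}_p\\ &&&q_n^{\infty}\end{pmatrix},\qquad q_m^{\infty}=\lim_{\alpha\to\infty}q_m^{(\theta\alpha)}.$$
   Context: $\mathbb{I}_p$ and $\mathbb{O}_p$ are the $p\times p$ identity and zero matrices. The generalized block qd-algorithm (finite discrete non-commutative hungry Toda-II lattice): given initial real $p\times p$ matrices $q_m^{(0)}$ ($1\le m\le n$) and $e_m^{(0)},\dots,e_m^{(\theta-1)}$ ($1\le m\le n-1$), the matrices $q_m^{(\alpha)},e_m^{(\alpha)}$ are determined for all $\alpha$ by $$q_m^{(\alpha+1)}+e_{m-1}^{(\alpha+\theta)}=q_m^{(\alpha)}+e_m^{(\alpha)}\quad(1\le m\le n,\ \alpha\ge0),$$ $$e_m^{(\alpha+\theta)}q_m^{(\alpha+1)}=q_{m+1}^{(\alpha)}e_m^{(\alpha)}\quad(1\le m\le n-1,\ \alpha\ge0),$$ $$e_0^{(\alpha)}=e_n^{(\alpha)}=\mathbb{O}_p\quad(\alpha\ge0).$$ It is assumed that the algorithm can be carried out for all $\alpha$, i.e. $q_m^{(\alpha+1)}$ is invertible for $1\le m\le n-1$ and all $\alpha\ge 0$ (so $e_m^{(\alpha+\theta)}=q_{m+1}^{(\alpha)}e_m^{(\alpha)}(q_m^{(\alpha+1)})^{-1}$). $\mathscr{R}_n^{(\alpha)}$ is the $n\times n$ block upper bidiagonal matrix (blocks $p\times p$) with diagonal blocks $q_1^{(\alpha)},\dots,q_n^{(\alpha)}$ and all superdiagonal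 blocks $\mathbb{I}_p$. $\mathscr{L}_n^{(\alpha)}$ is the $n\times n$ block lower bidiagonal matrix with diagonal blocks $\mathbb{I}_p$ and subdiagonal blocks $e_1^{(\alpha)},\dots,e_{n-1}^{(\alpha)}$ (with $e_m^{(\alpha)}$ in block position $(m+1,m)$). The $n-1$ leading (dominant) principal block minors of an $np\times np$ matrix are the determinants of its leading $kp\times kp$ submatrices, $k=1,\dots,n-1$. Definition of $\tilde L$: since the $n-1$ leading principal block minors of $X_n^{-1}$ are nonzero, there is a unique block decomposition $X_n^{-1}=L_YU_Y$ with $L_Y$ unit block lower triangular (diagonal blocks $\mathbb{I}_p$) and $U_Y$ block upper triangular. $\tilde L$ is the $np\times np$ matrix whose scalar entry in position $(a,b)$ equals $L_Y(a,b)$ if $D_n(a,a)=D_n(b,b)$, and equals $0$ otherwise; it is again unit block lower triangular. *)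

theory Defs
  imports Complex_Main "Jordan_Normal_Form.Char_Poly" "Jordan_Normal_Form.Spectral_Radius"
begin

text \<open>Blocks \<open>B i j\<close> (all \<open>p\<close> by \<open>p\<close>) are numbered from 1, as are the lattice variables \<open>q m \<alpha>\<close>
  and \<open>e m \<alpha>\<close>; scalar entries of a matrix are numbered from 0.\<close>

definition block_matrix :: "nat \<Rightarrow> nat \<Rightarrow> (nat \<Rightarrow> nat \<Rightarrow> 'a mat) \<Rightarrow> 'a mat" where
  "block_matrix n p B =
     mat (n * p) (n * p) (\<lambda>(a, b). B (a div p + 1) (b div p + 1) $$ (a mod p, b mod p))"

definition block_upper_bidiag :: "nat \<Rightarrow> nat \<Rightarrow> (nat \<Rightarrow> 'a :: {zero,one} mat) \<Rightarrow> 'a mat" where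
  "block_upper_bidiag n p Q = block_matrix n p
     (\<lambda>i j. if i = j then Q i else if j = i + 1 then 1\<^sub>m p else 0\<^sub>m p p)"

definition block_lower_bidiag :: "nat \<Rightarrow> nat \<Rightarrow> (nat \<Rightarrow> 'a :: {zero,one} mat) \<Rightarrow> 'a mat" where
  "block_lower_bidiag n p E = block_matrix n p
     (\<lambda>i j. if i = j then 1\<^sub>m p else if i = j + 1 then E j else 0\<^sub>m p p)"

definition qd_R :: "nat \<Rightarrow> nat \<Rightarrow> (nat \<Rightarrow> nat \<Rightarrow> real mat) \<Rightarrow> nat \<Rightarrow> real mat" where
  "qd_R n p q \<alpha> = block_upper_bidiag n p (\<lambda>m. q m \<alpha>)"

definition qd_L :: "nat \<Rightarrow> nat \<Rightarrow> (nat \<Rightarrow> nat \<Rightarrow> real mat) \<Rightarrow> nat \<Rightarrow> real mat" where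
  "qd_L n p e \<alpha> = block_lower_bidiag n p (\<lambda>m. e m \<alpha>)"

text \<open>\<open>qd_J n p \<theta> q e \<alpha> = L\<^sub>\<alpha> * (L\<^sub>\<alpha>\<^sub>+\<^sub>1 * (\<dots> * (L\<^sub>\<alpha>\<^sub>+\<^sub>\<theta>\<^sub>-\<^sub>1 * R\<^sub>\<alpha>)))\<close>\<close>

definition qd_J :: "nat \<Rightarrow> nat \<Rightarrow> nat \<Rightarrow> (nat \<Rightarrow> nat \<Rightarrow> real mat) \<Rightarrow> (nat \<Rightarrow> nat \<Rightarrow> real mat) \<Rightarrow>
    nat \<Rightarrow> real mat" where
  "qd_J n p \<theta> q e \<alpha> =
     foldr (\<lambda>k M. qd_L n p e k * M) [\<alpha>..<\<alpha> + \<theta>] (qd_R n p q \<alpha>)"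

definition block_qd :: "nat \<Rightarrow> nat \<Rightarrow> nat \<Rightarrow> (nat \<Rightarrow> nat \<Rightarrow> real mat) \<Rightarrow> (nat \<Rightarrow> nat \<Rightarrow> real mat) \<Rightarrow>
    bool" where
  "block_qd n p \<theta> q e \<longleftrightarrow>
     (\<forall>\<alpha>. \<forall>m\<in>{1..n}. q m \<alpha> \<in> carrier_mat p p) \<and>
     (\<forall>\<alpha>. \<forall>m\<in>{0..n}. e m \<alpha> \<in> carrier_mat p p) \<and>
     (\<forall>\<alpha>. \<forall>m\<in>{1..n}. q m (\<alpha> + 1) + e (m - 1) (\<alpha> + \<theta>) = q m \<alpha> + e m \<alpha>) \<and>
     (\<forall>\<alpha>. \<forall>m\<in>{1..<n}. e m (\<alpha> + \<theta>) * q m (\<alpha> + 1) = q (m + 1) \<alpha> * e m \<alpha>) \<and>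
     (\<forall>\<alpha>. e 0 \<alpha> = 0\<^sub>m p p \<and> e n \<alpha> = 0\<^sub>m p p)"

definition leading_block_minor :: "nat \<Rightarrow> nat \<Rightarrow> 'a :: comm_ring_1 mat \<Rightarrow> 'a" where
  "leading_block_minor p k A = det (mat (k * p) (k * p) (($$) A))"

definition leading_block_minors_nonzero :: "nat \<Rightarrow> nat \<Rightarrow> 'a :: comm_ring_1 mat \<Rightarrow> bool" where
  "leading_block_minors_nonzero n p A \<longleftrightarrow> (\<forall>k\<in>{1..<n}. leading_block_minor p k A \<noteq> 0)"

definition unit_block_lower :: "nat \<Rightarrow> nat \<Rightarrow> 'a :: {zero,one} mat \<Rightarrow> bool" where
  "unit_block_lower n p L \<longleftrightarrow> L \<in> carrier_mat (n * p) (n * p) \<and>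
     (\<forall>a < n * p. \<forall>b < n * p.
        (a div p = b div p \<longrightarrow> L $$ (a, b) = (if a = b then 1 else 0)) \<and>
        (a div p < b div p \<longrightarrow> L $$ (a, b) = 0))"

definition block_upper :: "nat \<Rightarrow> nat \<Rightarrow> 'a :: zero mat \<Rightarrow> bool" where
  "block_upper n p U \<longleftrightarrow> U \<in> carrier_mat (n * p) (n * p) \<and>
     (\<forall>a < n * p. \<forall>b < n * p. b div p < a div p \<longrightarrow> U $$ (a, b) = 0)"

text \<open>The lower factor of the block LU decomposition. Existence and uniqueness hold over a field when
  the first \<open>n - 1\<close> leading block minors of \<open>A\<close> are nonzero, even if \<open>A\<close> itself is singular.\<close>

definition block_LU_lower :: "nat \<Rightarrow> nat \<Rightarrow> 'a :: field mat \<Rightarrow> 'a mat" where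
  "block_LU_lower n p A =
     (THE L. unit_block_lower n p L \<and> (\<exists>U. block_upper n p U \<and> A = L * U))"

definition repeated_diag :: "nat \<Rightarrow> (nat \<Rightarrow> 'a :: zero) \<Rightarrow> (nat \<Rightarrow> nat) \<Rightarrow> 'a mat" where
  "repeated_diag s lam eta =
     (let ls = concat (map (\<lambda>i. replicate (eta i) (lam i)) [1..<s + 1])
      in mat_diag (length ls) ((!) ls))"

definition restrict_to_eigenblocks :: "'a :: zero mat \<Rightarrow> 'a mat \<Rightarrow> 'a mat" where
  "restrict_to_eigenblocks D L = mat (dim_row L) (dim_col L)
     (\<lambda>(a, b). if D $$ (a, a) = D $$ (b, b) then L $$ (a, b) else 0)"

definition mat_tendsto :: "(nat \<Rightarrow> 'a :: topological_space mat) \<Rightarrow> 'a mat \<Rightarrow> bool" where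
  "mat_tendsto A B \<longleftrightarrow>
     (\<forall>k. A k \<in> carrier_mat (dim_row B) (dim_col B)) \<and>
     (\<forall>i < dim_row B. \<forall>j < dim_col B. (\<lambda>k. A k $$ (i, j)) \<longlonglongrightarrow> B $$ (i, j))"

end

theory Submission
  imports Defs
begin

text \<open>Write \<open>P\<^sub>\<alpha> = L\<^sub>0 * \<dots> * L\<^sub>\<alpha>\<^sub>-\<^sub>1\<close>. The lattice equations say \<open>R\<^sub>\<alpha> * L\<^sub>\<alpha> = L\<^sub>\<alpha>\<^sub>+\<^sub>\<theta> * R\<^sub>\<alpha>\<^sub>+\<^sub>1\<close>, which gives
  \<open>J\<^sub>0 * P\<^sub>\<alpha> = P\<^sub>\<alpha> * J\<^sub>\<alpha> = P\<^sub>\<alpha>\<^sub>+\<^sub>\<theta> * R\<^sub>\<alpha>\<close>; hence the \<open>k\<close>-th power of \<open>J\<^sub>0\<close> is \<open>P\<^sub>k\<^sub>\<theta>\<close> times a block upper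
  triangular matrix. On the other hand, let \<open>L * U\<close> be the block LU decomposition of the inverse of
  \<open>X\<close> and let \<open>M\<^sub>k\<close> be \<open>L\<close> with the entry \<open>(a, b)\<close> scaled by the \<open>k\<close>-th power of \<open>\<lambda>\<^sub>a / \<lambda>\<^sub>b\<close>: then the
  \<open>k\<close>-th power of \<open>J\<^sub>0\<close> is \<open>X * M\<^sub>k\<close> times a block upper triangular matrix. So \<open>P\<^sub>k\<^sub>\<theta>\<close> is the lower factor
  of \<open>X * M\<^sub>k\<close>, and since \<open>M\<^sub>k\<close> converges to the restriction of \<open>L\<close> to the eigenblocks,
  \<open>P\<^sub>k\<^sub>\<theta>\<close> converges to a unit block lower triangular \<open>P\<close>. Both \<open>J\<^sub>k\<^sub>\<theta> = P\<^sub>k\<^sub>\<theta>\<inverse> * J\<^sub>0 * P\<^sub>k\<^sub>\<theta>\<close> and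
  \<open>R\<^sub>k\<^sub>\<theta> = P\<^sub>(\<^sub>k\<^sub>+\<^sub>1\<^sub>)\<^sub>\<theta>\<inverse> * J\<^sub>0 * P\<^sub>k\<^sub>\<theta>\<close> then have the limit \<open>P\<inverse> * J\<^sub>0 * P\<close>.\<close>

subsection \<open>Block triangular matrices\<close>

lemma mult_mat_entry:
  assumes "A \<in> carrier_mat l m" "B \<in> carrier_mat m r" "i < l" "j < r"
  shows "(A * B) $$ (i, j) = (\<Sum>c<m. A $$ (i, c) * B $$ (c, j))"
  using assms by (simp add: scalar_prod_def atLeast0LessThan)

abbreviation leading_submat :: "nat \<Rightarrow> 'a mat \<Rightarrow> 'a mat" where
  "leading_submat m A \<equiv> mat m m (($$) A)"

lemma unit_block_lowerD:
  assumes "unit_block_lower n p L"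
  shows "L \<in> carrier_mat (n * p) (n * p)"
    and "a < n * p \<Longrightarrow> b < n * p \<Longrightarrow> a div p \<le> b div p \<Longrightarrow> L $$ (a, b) = (if a = b then 1 else 0)"
  using assms unfolding unit_block_lower_def by (auto simp: le_less)

lemma block_upperD:
  assumes "block_upper n p U"
  shows "U \<in> carrier_mat (n * p) (n * p)"
    and "a < n * p \<Longrightarrow> b < n * p \<Longrightarrow> b div p < a div p \<Longrightarrow> U $$ (a, b) = 0"
  using assms unfolding block_upper_def by auto

lemma unit_block_lowerI:
  assumes "L \<in> carrier_mat (n * p) (n * p)"
    and "\<And>a b. a < n * p \<Longrightarrow> b < n * p \<Longrightarrow> a div p \<le> b div p \<Longrightarrow> L $$ (a, b) = (if a = b then 1 else 0)"
  shows "unit_block_lower n p L"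
  unfolding unit_block_lower_def
proof (intro conjI allI impI)
  fix a b assume "a < n * p" "b < n * p" "a div p < b div p"
  moreover from this have "a \<noteq> b" by auto
  ultimately show "L $$ (a, b) = 0" using assms(2)[of a b] by simp
qed (use assms in auto)

lemma unit_block_lower_one: "unit_block_lower n p (1\<^sub>m (n * p))"
  by (rule unit_block_lowerI) auto

lemma block_upper_one: "block_upper n p (1\<^sub>m (n * p))"
  unfolding block_upper_def by auto

lemma unit_block_lower_mult:
  fixes K :: "'a :: comm_ring_1 mat"
  assumes K: "unit_block_lower n p K" and L: "unit_block_lower n p L"
  shows "unit_block_lower n p (K * L)"
proof (rule unit_block_lowerI)
  show "K * L \<in> carrier_mat (n * p) (n * p)"
    using unit_block_lowerD(1)[OF K] unit_block_lowerD(1)[OF L] by simp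
  fix a b assume ab: "a < n * p" "b < n * p" "a div p \<le> b div p"
  have "K $$ (a, c) * L $$ (c, b) = (if c = a then L $$ (a, b) else 0)" if "c < n * p" for c
  proof (cases "a div p \<le> c div p")
    case True
    then show ?thesis using unit_block_lowerD(2)[OF K ab(1) that] by auto
  next
    case False
    then have "c \<noteq> a" "c \<noteq> b" "c div p \<le> b div p" using ab by auto
    then show ?thesis using unit_block_lowerD(2)[OF L that ab(2)] by auto
  qed
  then have "(K * L) $$ (a, b) = (\<Sum>c<n*p. if c = a then L $$ (a, b) else 0)"
    using mult_mat_entry[OF unit_block_lowerD(1)[OF K] unit_block_lowerD(1)[OF L] ab(1,2)] by simp
  also have "\<dots> = (if a = b then 1 else 0)"
    using ab unit_block_lowerD(2)[OF L ab] by simp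
  finally show "(K * L) $$ (a, b) = (if a = b then 1 else 0)" .
qed

lemma block_upper_mult:
  fixes U :: "'a :: comm_ring_1 mat"
  assumes U: "block_upper n p U" and W: "block_upper n p W"
  shows "block_upper n p (U * W)"
  unfolding block_upper_def
proof (intro conjI allI impI)
  show "U * W \<in> carrier_mat (n * p) (n * p)"
    using block_upperD(1)[OF U] block_upperD(1)[OF W] by simp
  fix a b assume ab: "a < n * p" "b < n * p" "b div p < a div p"
  have "U $$ (a, c) * W $$ (c, b) = 0" if "c < n * p" for c
    using block_upperD(2)[OF U ab(1) that] block_upperD(2)[OF W that ab(2)] ab(3)
    by (cases "c div p < a div p") auto
  then show "(U * W) $$ (a, b) = 0"
    using mult_mat_entry[OF block_upperD(1)[OF U] block_upperD(1)[OF W] ab(1,2)] by simp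
qed

text \<open>The first \<open>k\<close> block columns of \<open>U\<close> vanish below block row
  \<open>k\<close>, so passing to leading submatrices commutes with right multiplication by
  \<open>U\<close>.\<close>

lemma leading_block_minor_mult_upper:
  fixes A :: "'a :: comm_ring_1 mat"
  assumes A: "A \<in> carrier_mat (n * p) (n * p)" and U: "block_upper n p U" and "k \<le> n"
  shows "leading_block_minor p k (A * U) = leading_block_minor p k A * leading_block_minor p k U"
proof -
  have le: "k * p \<le> n * p" using \<open>k \<le> n\<close> by simp
  have "leading_submat (k * p) (A * U) = leading_submat (k * p) A * leading_submat (k * p) U"
  proof (rule eq_matI)
    fix i j assume "i < dim_row (leading_submat (k * p) A * leading_submat (k * p) U)"
      "j < dim_col (leading_submat (k * p) A * leading_submat (k * p) U)"
    then have ij: "i < k * p" "j < k * p" by auto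
    then have ij': "i < n * p" "j < n * p" using le by linarith+
    have "p > 0" using ij by (cases p) auto
    have "A $$ (i, c) * U $$ (c, j) = 0" if "c \<in> {..<n*p} - {..<k*p}" for c
    proof -
      have "k \<le> c div p" "j div p < k"
        using that ij \<open>p > 0\<close> by (auto simp: less_eq_div_iff_mult_less_eq div_less_iff_less_mult)
      then show ?thesis using block_upperD(2)[OF U _ ij'(2), of c] that by auto
    qed
    then have "(A * U) $$ (i, j) = (\<Sum>c<k*p. A $$ (i, c) * U $$ (c, j))"
      unfolding mult_mat_entry[OF A block_upperD(1)[OF U] ij']
      by (intro sum.mono_neutral_right) (use le in auto)
    then show "leading_submat (k * p) (A * U) $$ (i, j)
        = (leading_submat (k * p) A * leading_submat (k * p) U) $$ (i, j)"
      using ij by (simp add: scalar_prod_def atLeast0LessThan)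
  qed auto
  then show ?thesis unfolding leading_block_minor_def
    by (simp add: det_mult[of _ "k * p"])
qed

text \<open>The first \<open>k\<close> block rows of \<open>L\<close> vanish beyond block column
  \<open>k\<close>, so truncation commutes with left multiplication by \<open>L\<close>. Identity
  diagonal blocks make the leading part of \<open>L\<close> scalar lower triangular with determinant
  1.\<close>

lemma leading_block_minor_mult_lower:
  fixes A :: "'a :: comm_ring_1 mat"
  assumes A: "A \<in> carrier_mat (n * p) (n * p)" and L: "unit_block_lower n p L" and "k \<le> n"
  shows "leading_block_minor p k (L * A) = leading_block_minor p k A"
proof -
  have le: "k * p \<le> n * p" using \<open>k \<le> n\<close> by simp
  have "leading_submat (k * p) (L * A) = leading_submat (k * p) L * leading_submat (k * p) A"
  proof (rule eq_matI)
    fix i j assume "i < dim_row (leading_submat (k * p) L * leading_submat (k * p) A)"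
      "j < dim_col (leading_submat (k * p) L * leading_submat (k * p) A)"
    then have ij: "i < k * p" "j < k * p" by auto
    then have ij': "i < n * p" "j < n * p" using le by linarith+
    have "p > 0" using ij by (cases p) auto
    have "L $$ (i, c) * A $$ (c, j) = 0" if "c \<in> {..<n*p} - {..<k*p}" for c
    proof -
      have "k \<le> c div p" "i div p < k" "c \<noteq> i"
        using that ij \<open>p > 0\<close> by (auto simp: less_eq_div_iff_mult_less_eq div_less_iff_less_mult)
      then show ?thesis using unit_block_lowerD(2)[OF L ij'(1), of c] that by auto
    qed
    then have "(L * A) $$ (i, j) = (\<Sum>c<k*p. L $$ (i, c) * A $$ (c, j))"
      unfolding mult_mat_entry[OF unit_block_lowerD(1)[OF L] A ij']
      by (intro sum.mono_neutral_right) (use le in auto)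
    then show "leading_submat (k * p) (L * A) $$ (i, j)
        = (leading_submat (k * p) L * leading_submat (k * p) A) $$ (i, j)"
      using ij by (simp add: scalar_prod_def atLeast0LessThan)
  qed auto
  moreover have "det (leading_submat (k * p) L) = 1"
  proof -
    have lt: "i < n * p" if "i < k * p" for i using that le by linarith
    have "det (leading_submat (k * p) L) = prod_list (diag_mat (leading_submat (k * p) L))"
      by (rule det_lower_triangular[of "k * p"])
        (use unit_block_lowerD(2)[OF L lt lt] in \<open>auto simp: div_le_mono\<close>)
    also have "\<dots> = (\<Prod>i = 0..<k*p. L $$ (i, i))"
      unfolding prod_list_diag_prod by (rule prod.cong) auto
    also have "\<dots> = 1"
      by (rule prod.neutral) (use unit_block_lowerD(2)[OF L lt lt] in auto)
    finally show ?thesis .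
  qed
  ultimately show ?thesis unfolding leading_block_minor_def
    by (simp add: det_mult[of _ "k * p"])
qed

text \<open>Multiplying the row vector equation by the adjugate instead of an inverse keeps the
  argument valid over an integral domain.\<close>

lemma left_kernel_leading_block:
  fixes U :: "'a :: idom mat"
  assumes det: "leading_block_minor p k U \<noteq> 0"
    and zero: "\<And>b. b < k * p \<Longrightarrow> (\<Sum>c<k*p. f c * U $$ (c, b)) = 0" and c: "c < k * p"
  shows "f c = 0"
proof -
  let ?U = "leading_submat (k * p) U"
  let ?F = "mat 1 (k * p) (\<lambda>(_, c). f c)"
  have U: "?U \<in> carrier_mat (k * p) (k * p)" by simp
  have FU: "?F * ?U = 0\<^sub>m 1 (k * p)"
    by (rule eq_matI) (auto simp: scalar_prod_def atLeast0LessThan zero)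
  have "?F * (?U * adj_mat ?U) = (?F * ?U) * adj_mat ?U"
    by (rule assoc_mult_mat[symmetric]) (use adj_mat(1)[OF U] in auto)
  also have "\<dots> = 0\<^sub>m 1 (k * p)" unfolding FU using adj_mat(1)[OF U] by simp
  also have "?F * (?U * adj_mat ?U) = det ?U \<cdot>\<^sub>m (?F * 1\<^sub>m (k * p))"
    unfolding adj_mat(2)[OF U] by (rule mult_smult_distrib) auto
  also have "?F * 1\<^sub>m (k * p) = ?F" by (rule right_mult_one_mat[of _ 1]) simp
  finally have "det ?U \<cdot>\<^sub>m ?F = 0\<^sub>m 1 (k * p)" .
  then have "(det ?U \<cdot>\<^sub>m ?F) $$ (0, c) = (0\<^sub>m 1 (k * p) :: 'a mat) $$ (0, c)" by simp
  then have "det ?U * f c = 0" using c by simp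
  then show ?thesis using det unfolding leading_block_minor_def by simp
qed

text \<open>This rigidity yields uniqueness of block LU factors: left of its diagonal block, row
  \<open>a\<close> of \<open>T\<close> lies in the left kernel of a leading block submatrix of
  \<open>V\<close>. That submatrix has at most \<open>n - 1\<close> block rows, so the last diagonal
  block of \<open>V\<close> may be singular.\<close>

lemma unit_block_lower_eq_one:
  fixes T :: "'a :: idom mat"
  assumes T: "unit_block_lower n p T" and V: "block_upper n p V" and TV: "block_upper n p (T * V)"
    and minors: "leading_block_minors_nonzero n p V"
  shows "T = 1\<^sub>m (n * p)"
proof (rule eq_matI)
  fix a b assume "a < dim_row (1\<^sub>m (n * p))" "b < dim_col (1\<^sub>m (n * p))"
  then have ab: "a < n * p" "b < n * p" by auto
  then have "p > 0" by (cases p) auto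
  show "T $$ (a, b) = 1\<^sub>m (n * p) $$ (a, b)"
  proof (cases "a div p \<le> b div p")
    case True
    then show ?thesis using unit_block_lowerD(2)[OF T ab] ab by simp
  next
    case False
    define k where "k = a div p"
    have "0 < k" "k < n" using False ab \<open>p > 0\<close> by (simp_all add: k_def div_less_iff_less_mult)
    then have k: "k \<in> {1..<n}" by simp
    have ka: "k * p \<le> a" unfolding k_def by simp
    have "(\<Sum>c<k*p. T $$ (a, c) * V $$ (c, d)) = 0" if "d < k * p" for d
    proof -
      have d: "d < n * p" "d div p < a div p"
        using that ka ab \<open>p > 0\<close> by (linarith, simp add: k_def div_less_iff_less_mult)
      \<comment> \<open>From column \<open>k * p\<close> on, row \<open>a\<close> of
        \<open>T\<close> contains only its diagonal 1, which meets an entry of \<open>V\<close>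
        below the block diagonal.\<close>
      have "T $$ (a, c) * V $$ (c, d) = 0" if "c \<in> {..<n*p} - {..<k*p}" for c
      proof -
        have "a div p \<le> c div p"
          using that \<open>p > 0\<close> by (auto simp: k_def less_eq_div_iff_mult_less_eq)
        then show ?thesis
          using unit_block_lowerD(2)[OF T ab(1), of c] block_upperD(2)[OF V ab(1) d] that by auto
      qed
      then have "(\<Sum>c<k*p. T $$ (a, c) * V $$ (c, d)) = (\<Sum>c<n*p. T $$ (a, c) * V $$ (c, d))"
        by (intro sum.mono_neutral_left) (use le_less_trans[OF ka ab(1)] in auto)
      also have "\<dots> = (T * V) $$ (a, d)"
        using mult_mat_entry[OF unit_block_lowerD(1)[OF T] block_upperD(1)[OF V] ab(1) d(1)] by simp
      also have "\<dots> = 0" using block_upperD(2)[OF TV ab(1) d] .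
      finally show ?thesis .
    qed
    then have "T $$ (a, b) = 0"
      using left_kernel_leading_block[of p k V "\<lambda>c. T $$ (a, c)" b] minors k False \<open>p > 0\<close>
      by (auto simp: leading_block_minors_nonzero_def k_def div_less_iff_less_mult[symmetric])
    then show ?thesis using False ab by auto
  qed
qed (use unit_block_lowerD(1)[OF T] in auto)

subsection \<open>The lower factor of the block LU decomposition\<close>

text \<open>Row \<open>a\<close> to the left of its diagonal block solves a linear system with a leading block
  submatrix of \<open>A\<close>, so that \<open>block_eliminator n p A * A\<close> is block upper triangular: this is the
  inverse of the lower factor of \<open>A\<close>, as an explicit rational function of the entries of \<open>A\<close>.\<close>

definition block_eliminator :: "nat \<Rightarrow> nat \<Rightarrow> 'a :: field mat \<Rightarrow> 'a mat" where
  "block_eliminator n p A = mat (n * p) (n * p) (\<lambda>(a, b).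
     let m = (a div p) * p in
     if b < m then - (\<Sum>c<m. A $$ (a, c) * adj_mat (leading_submat m A) $$ (c, b)) / det (leading_submat m A)
     else if a = b then 1 else 0)"

lemma unit_block_lower_block_eliminator: "unit_block_lower n p (block_eliminator n p A)"
proof (rule unit_block_lowerI)
  fix a b assume ab: "a < n * p" "b < n * p" "a div p \<le> b div p"
  then have "p > 0" by (cases p) auto
  then have "\<not> b < (a div p) * p" using ab(3) by (simp add: div_less_iff_less_mult[symmetric])
  then show "block_eliminator n p A $$ (a, b) = (if a = b then 1 else 0)"
    using ab by (simp add: block_eliminator_def Let_def)
qed (simp add: block_eliminator_def)

lemma block_upper_block_eliminator_mult:
  assumes A: "A \<in> carrier_mat (n * p) (n * p)" and minors: "leading_block_minors_nonzero n p A"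
  shows "block_upper n p (block_eliminator n p A * A)"
  unfolding block_upper_def
proof (intro conjI allI impI)
  let ?N = "block_eliminator n p A"
  note N = unit_block_lower_block_eliminator[of n p A]
  show "?N * A \<in> carrier_mat (n * p) (n * p)" using unit_block_lowerD(1)[OF N] A by simp
  fix a b assume ab: "a < n * p" "b < n * p" "b div p < a div p"
  then have "p > 0" by (cases p) auto
  define m where "m = (a div p) * p"
  define B where "B = leading_submat m A"
  have B: "B \<in> carrier_mat m m" unfolding B_def by simp
  have bm: "b < m" using ab \<open>p > 0\<close> by (simp add: m_def div_less_iff_less_mult[symmetric])
  have ma: "m \<le> a" unfolding m_def by simp
  have "0 < a div p" "a div p < n" using ab \<open>p > 0\<close> by (linarith, simp add: div_less_iff_less_mult)
  then have "a div p \<in> {1..<n}" by simp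
  then have det: "det B \<noteq> 0"
    using minors unfolding leading_block_minors_nonzero_def leading_block_minor_def B_def m_def
    by blast
  have tail: "?N $$ (a, c) = (if a = c then 1 else 0)" if "c < n * p" "m \<le> c" for c
    using that ab by (simp add: block_eliminator_def Let_def m_def)
  have head: "?N $$ (a, c) = - (\<Sum>d<m. A $$ (a, d) * adj_mat B $$ (d, c)) / det B" if "c < m" for c
    using that ab less_le_trans[OF that ma] by (simp add: block_eliminator_def Let_def m_def B_def)
  have adj: "(\<Sum>c<m. adj_mat B $$ (d, c) * A $$ (c, b)) = (if d = b then det B else 0)"
    if "d < m" for d
  proof -
    have "(\<Sum>c<m. adj_mat B $$ (d, c) * A $$ (c, b)) = (adj_mat B * B) $$ (d, b)"
      unfolding mult_mat_entry[OF adj_mat(1)[OF B] B that bm]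
      by (rule sum.cong) (use bm in \<open>auto simp: B_def\<close>)
    also have "\<dots> = (if d = b then det B else 0)" using that bm by (simp add: adj_mat(3)[OF B])
    finally show ?thesis .
  qed
  \<comment> \<open>Swapping the sums produces \<open>adj_mat B * B\<close>, a scalar matrix, so
    only \<open>d = b\<close> survives. The result cancels the contribution of the diagonal 1 of the
    eliminator.\<close>
  have "(\<Sum>c<m. ?N $$ (a, c) * A $$ (c, b))
      = (\<Sum>c<m. \<Sum>d<m. - A $$ (a, d) * (adj_mat B $$ (d, c) * A $$ (c, b)) / det B)"
    by (simp add: head sum_distrib_right sum_divide_distrib sum_negf[symmetric] mult.assoc)
  also have "\<dots> = (\<Sum>d<m. - A $$ (a, d) * (\<Sum>c<m. adj_mat B $$ (d, c) * A $$ (c, b)) / det B)"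
    by (subst sum.swap) (simp add: sum_distrib_left sum_divide_distrib)
  also have "\<dots> = (\<Sum>d<m. if d = b then - A $$ (a, b) else 0)"
    by (rule sum.cong) (use adj det in auto)
  also have "\<dots> = - A $$ (a, b)" using bm by simp
  finally have 1: "(\<Sum>c<m. ?N $$ (a, c) * A $$ (c, b)) = - A $$ (a, b)" .
  have "(\<Sum>c\<in>{..<n*p} - {..<m}. ?N $$ (a, c) * A $$ (c, b))
      = (\<Sum>c\<in>{..<n*p} - {..<m}. if c = a then A $$ (a, b) else 0)"
    by (rule sum.cong) (auto simp: tail)
  also have "\<dots> = A $$ (a, b)" using ab ma by simp
  finally have 2: "(\<Sum>c\<in>{..<n*p} - {..<m}. ?N $$ (a, c) * A $$ (c, b)) = A $$ (a, b)" .
  have "(?N * A) $$ (a, b) = (\<Sum>c<n*p. ?N $$ (a, c) * A $$ (c, b))"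
    by (rule mult_mat_entry[OF unit_block_lowerD(1)[OF N] A ab(1,2)])
  also have "\<dots> = (\<Sum>c\<in>{..<n*p} - {..<m}. ?N $$ (a, c) * A $$ (c, b)) + (\<Sum>c<m. ?N $$ (a, c) * A $$ (c, b))"
    by (rule sum.subset_diff) (use ma ab in auto)
  finally show "(?N * A) $$ (a, b) = 0" using 1 2 by simp
qed

lemma det_unit_block_lower:
  fixes L :: "'a :: comm_ring_1 mat"
  assumes L: "unit_block_lower n p L"
  shows "det L = 1"
proof -
  have "leading_block_minor p n (L * 1\<^sub>m (n * p)) = leading_block_minor p n (1\<^sub>m (n * p) :: 'a mat)"
    by (rule leading_block_minor_mult_lower[OF _ L]) auto
  moreover have "leading_submat (n * p) A = A" if "A \<in> carrier_mat (n * p) (n * p)" for A :: "'a mat"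
    using that by (intro eq_matI) auto
  ultimately show ?thesis
    using unit_block_lowerD(1)[OF L] by (simp add: leading_block_minor_def)
qed

text \<open>Forward substitution: by strong induction on the row index, the rows of \<open>L\<close>
  in earlier blocks already vanish at column \<open>b\<close>, so the row equation of
  \<open>N * L = 1\<close> retains only the term \<open>c = a\<close>.\<close>

lemma unit_block_lower_inverse:
  fixes N :: "'a :: comm_ring_1 mat"
  assumes N: "unit_block_lower n p N" and L: "L \<in> carrier_mat (n * p) (n * p)"
    and NL: "N * L = 1\<^sub>m (n * p)"
  shows "unit_block_lower n p L"
proof (rule unit_block_lowerI[OF L])
  fix a b assume "a < n * p" "b < n * p" "a div p \<le> b div p"
  then show "L $$ (a, b) = (if a = b then 1 else 0)"
  proof (induction a rule: less_induct)
    case (less a)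
    then have "p > 0" by (cases p) auto
    have "N $$ (a, c) * L $$ (c, b) = (if c = a then L $$ (a, b) else 0)" if c: "c < n * p" for c
    proof (cases "a div p \<le> c div p")
      case True
      then show ?thesis using unit_block_lowerD(2)[OF N less.prems(1) c] by auto
    next
      case False
      then have "c < a" using div_le_mono[of a c p] by linarith
      moreover have "c \<noteq> b" "c div p \<le> b div p" using less.prems False by auto
      ultimately show ?thesis using less.IH[of c] less.prems c by auto
    qed
    then have "(N * L) $$ (a, b) = (\<Sum>c<n*p. if c = a then L $$ (a, b) else 0)"
      using mult_mat_entry[OF unit_block_lowerD(1)[OF N] L less.prems(1,2)] by simp
    then show ?case using less.prems by (simp add: NL)
  qed
qed

text \<open>With \<open>N\<close> the eliminator, \<open>N * L\<close> is unit block lower,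
  \<open>N * L * V = N * A * W\<close> is block upper, and \<open>V\<close> inherits nonzero leading
  minors from \<open>A\<close> and \<open>W\<close>, so the rigidity lemma applies. The factor
  \<open>W\<close> is 1 for uniqueness of the LU decomposition and a diagonal power times
  \<open>U\<close> in the LR iteration.\<close>

lemma block_eliminator_mult_lower:
  assumes A: "A \<in> carrier_mat (n * p) (n * p)" and minors: "leading_block_minors_nonzero n p A"
    and W: "block_upper n p W" and Wm: "leading_block_minors_nonzero n p W"
    and L: "unit_block_lower n p L" and V: "block_upper n p V" and eq: "L * V = A * W"
  shows "block_eliminator n p A * L = 1\<^sub>m (n * p)"
proof (rule unit_block_lower_eq_one[OF _ V])
  let ?N = "block_eliminator n p A"
  note N = unit_block_lower_block_eliminator[of n p A]
  show "unit_block_lower n p (?N * L)" by (rule unit_block_lower_mult[OF N L])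
  have "?N * L * V = ?N * (A * W)"
    using eq assoc_mult_mat[OF unit_block_lowerD(1)[OF N] unit_block_lowerD(1)[OF L] block_upperD(1)[OF V]]
    by simp
  also have "\<dots> = ?N * A * W"
    using assoc_mult_mat[OF unit_block_lowerD(1)[OF N] A block_upperD(1)[OF W]] by simp
  finally show "block_upper n p (?N * L * V)"
    using block_upper_mult[OF block_upper_block_eliminator_mult[OF A minors] W] by simp
  show "leading_block_minors_nonzero n p V"
    unfolding leading_block_minors_nonzero_def
  proof
    fix k assume k: "k \<in> {1..<n}"
    have "leading_block_minor p k V = leading_block_minor p k (A * W)"
      using leading_block_minor_mult_lower[OF block_upperD(1)[OF V] L, of k] k eq by simp
    also have "\<dots> = leading_block_minor p k A * leading_block_minor p k W"
      using leading_block_minor_mult_upper[OF A W, of k] k by simp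
    finally show "leading_block_minor p k V \<noteq> 0"
      using minors Wm k unfolding leading_block_minors_nonzero_def by simp
  qed
qed

lemma leading_block_minors_nonzero_one:
  "leading_block_minors_nonzero n p (1\<^sub>m (n * p) :: 'a :: field mat)"
proof -
  have "leading_submat (k * p) (1\<^sub>m (n * p) :: 'a mat) = 1\<^sub>m (k * p)" if "k < n" for k
  proof -
    have "k * p \<le> n * p" using that by simp
    then have "i < n * p" if "i < k * p" for i using that by linarith
    then show ?thesis by (intro eq_matI) auto
  qed
  then show ?thesis
    unfolding leading_block_minors_nonzero_def leading_block_minor_def by simp
qed

text \<open>The eliminator has determinant 1, so its adjugate is its inverse and serves as lower
  factor. Any competing lower factor is inverted by the same eliminator, hence equal.\<close>

lemma block_LU_lower:
  fixes A :: "'a :: field mat"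
  assumes A: "A \<in> carrier_mat (n * p) (n * p)" and minors: "leading_block_minors_nonzero n p A"
  shows "unit_block_lower n p (block_LU_lower n p A)"
    and "\<exists>U. block_upper n p U \<and> A = block_LU_lower n p A * U"
proof -
  let ?N = "block_eliminator n p A"
  let ?P = "\<lambda>L. unit_block_lower n p L \<and> (\<exists>U. block_upper n p U \<and> A = L * U)"
  note N = unit_block_lower_block_eliminator[of n p A]
  note Nc = unit_block_lowerD(1)[OF N]
  define L where "L = adj_mat ?N"
  have Lc: "L \<in> carrier_mat (n * p) (n * p)" unfolding L_def by (rule adj_mat(1)[OF Nc])
  have NL: "?N * L = 1\<^sub>m (n * p)" and LN: "L * ?N = 1\<^sub>m (n * p)"
    unfolding L_def using adj_mat(2,3)[OF Nc] det_unit_block_lower[OF N] by auto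
  have "A = L * (?N * A)" using assoc_mult_mat[OF Lc Nc A] LN A by simp
  then have PL: "?P L"
    using unit_block_lower_inverse[OF N Lc NL] block_upper_block_eliminator_mult[OF A minors] by blast
  moreover have "K = L" if PK: "?P K" for K
  proof -
    obtain U where U: "block_upper n p U" "A = K * U" using PK by blast
    have K: "unit_block_lower n p K" using PK by blast
    have "?N * K = 1\<^sub>m (n * p)"
      by (rule block_eliminator_mult_lower[OF A minors block_upper_one leading_block_minors_nonzero_one K U(1)])
        (use U A in \<open>simp add: right_mult_one_mat[of _ "n * p" "n * p"]\<close>)
    then have "L = L * (?N * K)" using Lc by simp
    also have "\<dots> = K" using assoc_mult_mat[OF Lc Nc unit_block_lowerD(1)[OF K]] LN
      unit_block_lowerD(1)[OF K] by simp
    finally show ?thesis by simp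
  qed
  ultimately have "?P (block_LU_lower n p A)"
    unfolding block_LU_lower_def by (rule theI)
  then show "unit_block_lower n p (block_LU_lower n p A)"
    "\<exists>U. block_upper n p U \<and> A = block_LU_lower n p A * U" by auto
qed

subsection \<open>Limits of matrices\<close>

lemma mat_tendstoD:
  assumes "mat_tendsto A B" and "B \<in> carrier_mat l m"
  shows "A k \<in> carrier_mat l m"
    and "i < l \<Longrightarrow> j < m \<Longrightarrow> (\<lambda>k. A k $$ (i, j)) \<longlonglongrightarrow> B $$ (i, j)"
  using assms unfolding mat_tendsto_def by auto

lemma mat_tendstoI:
  assumes "B \<in> carrier_mat l m" and "\<And>k. A k \<in> carrier_mat l m"
    and "\<And>i j. i < l \<Longrightarrow> j < m \<Longrightarrow> (\<lambda>k. A k $$ (i, j)) \<longlonglongrightarrow> B $$ (i, j)"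
  shows "mat_tendsto A B"
  using assms unfolding mat_tendsto_def by auto

lemma mat_tendsto_const: "mat_tendsto (\<lambda>_. A) A"
  unfolding mat_tendsto_def by auto

lemma mat_tendsto_mult:
  fixes A B :: "nat \<Rightarrow> 'a :: {real_normed_algebra, semiring_0} mat"
  assumes A: "mat_tendsto A A'" and B: "mat_tendsto B B'"
    and A': "A' \<in> carrier_mat l m" and B': "B' \<in> carrier_mat m r"
  shows "mat_tendsto (\<lambda>k. A k * B k) (A' * B')"
proof (rule mat_tendstoI)
  note Ac = mat_tendstoD[OF A A'] and Bc = mat_tendstoD[OF B B']
  show "A' * B' \<in> carrier_mat l r" "A k * B k \<in> carrier_mat l r" for k
    using A' B' Ac(1)[of k] Bc(1)[of k] by auto
  fix i j assume ij: "i < l" "j < r"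
  show "(\<lambda>k. (A k * B k) $$ (i, j)) \<longlonglongrightarrow> (A' * B') $$ (i, j)"
    unfolding mult_mat_entry[OF A' B' ij] mult_mat_entry[OF Ac(1) Bc(1) ij]
    by (intro tendsto_sum tendsto_mult Ac(2) Bc(2)) (use ij in auto)
qed

lemma tendsto_det:
  fixes A :: "nat \<Rightarrow> 'a :: real_normed_field mat"
  assumes A: "mat_tendsto A B" and B: "B \<in> carrier_mat m m"
  shows "(\<lambda>k. det (A k)) \<longlonglongrightarrow> det B"
  unfolding det_def'[OF B] det_def'[OF mat_tendstoD(1)[OF A B]]
proof (intro tendsto_sum tendsto_mult tendsto_prod tendsto_const)
  fix \<pi> i assume "\<pi> \<in> {\<pi>. \<pi> permutes {0..<m}}" "i \<in> {0..<m}"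
  then show "(\<lambda>k. A k $$ (i, \<pi> i)) \<longlonglongrightarrow> B $$ (i, \<pi> i)"
    using permutes_in_image[of \<pi> "{0..<m}" i] by (intro mat_tendstoD(2)[OF A B]) auto
qed

text \<open>Entries of the adjugate are signed determinants of matrices with a row and a column
  deleted, and deletion merely re-indexes entries.\<close>

lemma tendsto_adj_mat:
  fixes A :: "nat \<Rightarrow> 'a :: real_normed_field mat"
  assumes A: "mat_tendsto A B" and B: "B \<in> carrier_mat m m"
  shows "mat_tendsto (\<lambda>k. adj_mat (A k)) (adj_mat B)"
proof (rule mat_tendstoI[of _ m m])
  note Ac = mat_tendstoD[OF A B]
  show "adj_mat B \<in> carrier_mat m m" "adj_mat (A k) \<in> carrier_mat m m" for k
    using adj_mat(1)[OF B] adj_mat(1)[OF Ac(1)] by auto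
  fix i j assume ij: "i < m" "j < m"
  have "mat_tendsto (\<lambda>k. mat_delete (A k) j i) (mat_delete B j i)"
  proof (rule mat_tendstoI[of _ "m - 1" "m - 1"])
    show "mat_delete B j i \<in> carrier_mat (m - 1) (m - 1)"
      "mat_delete (A k) j i \<in> carrier_mat (m - 1) (m - 1)" for k
      using mat_delete_carrier[OF B] mat_delete_carrier[OF Ac(1)] by auto
    fix a b assume ab: "a < m - 1" "b < m - 1"
    have "mat_delete C j i $$ (a, b) = C $$ (if a < j then a else Suc a, if b < i then b else Suc b)"
      if "C \<in> carrier_mat m m" for C :: "'a mat"
      using that ab by (simp add: mat_delete_def)
    then show "(\<lambda>k. mat_delete (A k) j i $$ (a, b)) \<longlonglongrightarrow> mat_delete B j i $$ (a, b)"
      using B Ac(1) ab by (auto intro!: Ac(2))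
  qed
  then have "(\<lambda>k. (-1) ^ (j + i) * det (mat_delete (A k) j i)) \<longlonglongrightarrow> (-1) ^ (j + i) * det (mat_delete B j i)"
    by (intro tendsto_mult tendsto_const tendsto_det[of _ _ "m - 1"] mat_delete_carrier[OF B])
  then show "(\<lambda>k. adj_mat (A k) $$ (i, j)) \<longlonglongrightarrow> adj_mat B $$ (i, j)"
    using ij B Ac(1) by (simp add: adj_mat_def cofactor_def carrier_matD[OF Ac(1)])
qed

lemma tendsto_leading_submat:
  assumes A: "mat_tendsto A B" and B: "B \<in> carrier_mat l l" and "m \<le> l"
  shows "mat_tendsto (\<lambda>k. leading_submat m (A k)) (leading_submat m B)"
  by (rule mat_tendstoI[of _ m m]) (use assms in \<open>auto intro!: mat_tendstoD(2)[OF A B]\<close>)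

text \<open>Each entry is a rational function of the matrix entries whose denominator is a leading
  block minor with nonzero limit. This is the continuity of the inverse lower factor.\<close>

lemma tendsto_block_eliminator:
  fixes A :: "nat \<Rightarrow> 'a :: real_normed_field mat"
  assumes A: "mat_tendsto A B" and B: "B \<in> carrier_mat (n * p) (n * p)"
    and minors: "leading_block_minors_nonzero n p B"
  shows "mat_tendsto (\<lambda>k. block_eliminator n p (A k)) (block_eliminator n p B)"
proof (rule mat_tendstoI[of _ "n * p" "n * p"])
  fix a b assume ab: "a < n * p" "b < n * p"
  define m where "m = (a div p) * p"
  have ma: "m \<le> a" unfolding m_def by simp
  have sub: "mat_tendsto (\<lambda>k. leading_submat m (A k)) (leading_submat m B)"
    by (rule tendsto_leading_submat[OF A B]) (use ma ab in simp)
  show "(\<lambda>k. block_eliminator n p (A k) $$ (a, b)) \<longlonglongrightarrow> block_eliminator n p B $$ (a, b)"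
  proof (cases "b < m")
    case True
    then have "p > 0" using ab by (cases p) auto
    then have "0 < a div p" "a div p < n"
      using ab True by (auto simp: m_def div_less_iff_less_mult intro!: gr0I)
    then have "a div p \<in> {1..<n}" by simp
    then have det: "det (leading_submat m B) \<noteq> 0"
      using minors unfolding leading_block_minors_nonzero_def leading_block_minor_def m_def by blast
    have "(\<lambda>k. - (\<Sum>c<m. A k $$ (a, c) * adj_mat (leading_submat m (A k)) $$ (c, b)) / det (leading_submat m (A k)))
      \<longlonglongrightarrow> - (\<Sum>c<m. B $$ (a, c) * adj_mat (leading_submat m B) $$ (c, b)) / det (leading_submat m B)"
      using True ma ab
      by (intro tendsto_divide tendsto_minus tendsto_sum tendsto_mult det tendsto_det[OF sub, of m]
          mat_tendstoD(2)[OF A B] mat_tendstoD(2)[OF tendsto_adj_mat[OF sub, of m], of m m] adj_mat(1)) auto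
    then show ?thesis
      using ab True by (simp add: block_eliminator_def Let_def m_def)
  next
    case False
    then show ?thesis using ab by (simp add: block_eliminator_def Let_def m_def)
  qed
qed (auto simp: block_eliminator_def)

lemma eventually_leading_block_minors_nonzero:
  fixes A :: "nat \<Rightarrow> 'a :: real_normed_field mat"
  assumes A: "mat_tendsto A B" and B: "B \<in> carrier_mat (n * p) (n * p)"
    and minors: "leading_block_minors_nonzero n p B"
  shows "\<forall>\<^sub>F k in sequentially. leading_block_minors_nonzero n p (A k)"
proof -
  have "\<forall>\<^sub>F k in sequentially. leading_block_minor p i (A k) \<noteq> 0" if i: "i \<in> {1..<n}" for i
  proof -
    have "(\<lambda>k. det (leading_submat (i * p) (A k))) \<longlonglongrightarrow> det (leading_submat (i * p) B)"
      by (rule tendsto_det[of _ _ "i * p"], rule tendsto_leading_submat[OF A B]) (use i in auto)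
    moreover have "det (leading_submat (i * p) B) \<noteq> 0"
      using minors i unfolding leading_block_minors_nonzero_def leading_block_minor_def by blast
    ultimately show ?thesis
      unfolding leading_block_minor_def by (rule tendsto_imp_eventually_ne)
  qed
  then show ?thesis
    unfolding leading_block_minors_nonzero_def by (simp add: eventually_ball_finite)
qed

lemma mat_tendsto_eventually_cong:
  assumes A: "mat_tendsto A G" and G: "G \<in> carrier_mat l m"
    and B: "\<And>k. B k \<in> carrier_mat l m" and eq: "\<forall>\<^sub>F k in sequentially. A k = B k"
  shows "mat_tendsto B G"
proof (rule mat_tendstoI[OF G B])
  fix i j assume ij: "i < l" "j < m"
  show "(\<lambda>k. B k $$ (i, j)) \<longlonglongrightarrow> G $$ (i, j)"
    by (rule Lim_transform_eventually[OF mat_tendstoD(2)[OF A G ij]])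
      (use eq in \<open>auto elim: eventually_mono\<close>)
qed

lemma mat_tendsto_Suc:
  assumes "mat_tendsto A B"
  shows "mat_tendsto (\<lambda>k. A (Suc k)) B"
  using assms unfolding mat_tendsto_def by (auto intro: LIMSEQ_Suc)

subsection \<open>Block bidiagonal matrices\<close>

text \<open>The scalar summation index is cut into \<open>n\<close> runs of length \<open>p\<close>,
  one for each inner block index.\<close>

lemma block_matrix_mult_entry:
  fixes B C :: "nat \<Rightarrow> nat \<Rightarrow> 'a :: comm_ring_1 mat"
  assumes B: "\<And>i j. i \<in> {1..n} \<Longrightarrow> j \<in> {1..n} \<Longrightarrow> B i j \<in> carrier_mat p p"
    and C: "\<And>i j. i \<in> {1..n} \<Longrightarrow> j \<in> {1..n} \<Longrightarrow> C i j \<in> carrier_mat p p"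
    and ab: "a < n * p" "b < n * p"
  shows "(block_matrix n p B * block_matrix n p C) $$ (a, b) =
    (\<Sum>k = 1..n. (B (a div p + 1) k * C k (b div p + 1)) $$ (a mod p, b mod p))"
proof -
  have p: "p > 0" using ab by (cases p) auto
  have idx: "a div p + 1 \<in> {1..n}" "b div p + 1 \<in> {1..n}" "a mod p < p" "b mod p < p"
    using ab p div_less_iff_less_mult[OF p, of a n] div_less_iff_less_mult[OF p, of b n] by auto
  let ?f = "\<lambda>c. block_matrix n p B $$ (a, c) * block_matrix n p C $$ (c, b)"
  have "(block_matrix n p B * block_matrix n p C) $$ (a, b) = (\<Sum>c<n*p. ?f c)"
    by (rule mult_mat_entry[of _ "n*p" _ _ "n*p"]) (use ab in \<open>auto simp: block_matrix_def\<close>)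
  also have "\<dots> = (\<Sum>k<n. sum ?f {k*p..<k*p+p})" by (rule sum.nat_group[symmetric])
  also have "\<dots> = (\<Sum>k<n. (B (a div p + 1) (k + 1) * C (k + 1) (b div p + 1)) $$ (a mod p, b mod p))"
  proof (rule sum.cong[OF refl])
    fix k assume "k \<in> {..<n}"
    then have k: "k + 1 \<in> {1..n}" "k < n" by auto
    have "sum ?f {k*p..<k*p+p} = (\<Sum>z<p. ?f (k * p + z))"
      by (rule sum.reindex_bij_witness[of _ "\<lambda>z. k * p + z" "\<lambda>c. c - k * p"]) auto
    also have "\<dots> = (\<Sum>z<p. B (a div p + 1) (k + 1) $$ (a mod p, z) * C (k + 1) (b div p + 1) $$ (z, b mod p))"
    proof (rule sum.cong[OF refl])
      fix z assume "z \<in> {..<p}"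
      then have z: "z < p" by simp
      have "k * p + z < (k + 1) * p" using z by simp
      also have "\<dots> \<le> n * p" using k by (intro mult_le_mono1) auto
      finally show "?f (k * p + z) = B (a div p + 1) (k + 1) $$ (a mod p, z) * C (k + 1) (b div p + 1) $$ (z, b mod p)"
        using ab z by (simp add: block_matrix_def)
    qed
    finally show "sum ?f {k*p..<k*p+p} = (B (a div p + 1) (k + 1) * C (k + 1) (b div p + 1)) $$ (a mod p, b mod p)"
      using mult_mat_entry[OF B[OF idx(1) k(1)] C[OF k(1) idx(2)] idx(3,4)] by simp
  qed
  also have "\<dots> = (\<Sum>k = 1..n. (B (a div p + 1) k * C k (b div p + 1)) $$ (a mod p, b mod p))"
    by (rule sum.reindex_bij_witness[of _ "\<lambda>k. k - 1" "\<lambda>k. k + 1"]) auto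
  finally show ?thesis .
qed

text \<open>Only three block diagonals can be nonzero. The diagonal reproduces \<open>diag\<close>,
  the subdiagonal reproduces \<open>sub\<close>, and the superdiagonal is the identity on both
  sides; \<open>bd\<close> supplies the missing terms in the first and last block rows.\<close>

lemma block_upper_bidiag_mult_lower_bidiag:
  fixes Q E Q' E' :: "nat \<Rightarrow> 'a :: comm_ring_1 mat"
  assumes Q: "\<And>m. m \<in> {1..n} \<Longrightarrow> Q m \<in> carrier_mat p p" "\<And>m. m \<in> {1..n} \<Longrightarrow> Q' m \<in> carrier_mat p p"
    and E: "\<And>m. m \<in> {0..n} \<Longrightarrow> E m \<in> carrier_mat p p" "\<And>m. m \<in> {0..n} \<Longrightarrow> E' m \<in> carrier_mat p p"
    and diag: "\<And>m. m \<in> {1..n} \<Longrightarrow> Q' m + E' (m - 1) = Q m + E m"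
    and sub: "\<And>m. m \<in> {1..<n} \<Longrightarrow> E' m * Q' m = Q (m + 1) * E m"
    and bd: "E n = 0\<^sub>m p p" "E' 0 = 0\<^sub>m p p"
  shows "block_upper_bidiag n p Q * block_lower_bidiag n p E
    = block_lower_bidiag n p E' * block_upper_bidiag n p Q'"
proof (rule eq_matI)
  fix a b assume "a < dim_row (block_lower_bidiag n p E' * block_upper_bidiag n p Q')"
    "b < dim_col (block_lower_bidiag n p E' * block_upper_bidiag n p Q')"
  then have ab: "a < n * p" "b < n * p"
    by (auto simp: block_lower_bidiag_def block_upper_bidiag_def block_matrix_def)
  then have p: "p > 0" by (cases p) auto
  define i where "i = a div p + 1"
  define j where "j = b div p + 1"
  define x where "x = a mod p"
  define y where "y = b mod p"
  have i: "i \<in> {1..n}" and j: "j \<in> {1..n}" and xy: "x < p" "y < p"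
    unfolding i_def j_def x_def y_def
    using ab p div_less_iff_less_mult[OF p, of a n] div_less_iff_less_mult[OF p, of b n] by auto
  let ?R = "\<lambda>Q i j. if i = j then Q i else if j = i + 1 then 1\<^sub>m p else 0\<^sub>m p p"
  let ?L = "\<lambda>E i j. if i = j then 1\<^sub>m p else if i = j + 1 then E j else 0\<^sub>m p p"
  have Rc: "?R Q k l \<in> carrier_mat p p" "?R Q' k l \<in> carrier_mat p p"
    and Lc: "?L E k l \<in> carrier_mat p p" "?L E' k l \<in> carrier_mat p p"
    if "k \<in> {1..n}" "l \<in> {1..n}" for k l
    using that Q E by auto
  have "(block_upper_bidiag n p Q * block_lower_bidiag n p E) $$ (a, b)
    = (\<Sum>k = 1..n. (?R Q i k * ?L E k j) $$ (x, y))"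
    unfolding block_upper_bidiag_def block_lower_bidiag_def i_def j_def x_def y_def
    by (rule block_matrix_mult_entry) (use Rc Lc ab in blast)+
  \<comment> \<open>Row \<open>i\<close> of the upper bidiagonal factor has blocks only at
    \<open>k = i\<close> and \<open>k = i + 1\<close>; for \<open>i = n\<close> the latter leaves
    the range, hence the guard \<open>i < n\<close> afterwards.\<close>
  also have "\<dots> = (\<Sum>k = 1..n. (if k = i then (Q i * ?L E i j) $$ (x, y) else 0)
      + (if k = i + 1 then ?L E (i + 1) j $$ (x, y) else 0))"
    by (rule sum.cong[OF refl])
      (use Lc(1)[OF _ j] E(1)[of j] j xy in \<open>auto simp: left_mult_one_mat[of _ p p] left_mult_zero_mat[of _ p p]\<close>)
  also have "\<dots> = (Q i * ?L E i j) $$ (x, y) + (if i < n then ?L E (i + 1) j $$ (x, y) else 0)"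
    using i by (simp add: sum.distrib)
  finally have 1: "(block_upper_bidiag n p Q * block_lower_bidiag n p E) $$ (a, b) = \<dots>" .
  have "(block_lower_bidiag n p E' * block_upper_bidiag n p Q') $$ (a, b)
    = (\<Sum>k = 1..n. (?L E' i k * ?R Q' k j) $$ (x, y))"
    unfolding block_upper_bidiag_def block_lower_bidiag_def i_def j_def x_def y_def
    by (rule block_matrix_mult_entry) (use Rc Lc ab in blast)+
  \<comment> \<open>For \<open>i = 1\<close> the index \<open>i - 1 = 0\<close> lies outside the
    block numbering, hence the guard \<open>1 < i\<close> afterwards.\<close>
  also have "\<dots> = (\<Sum>k = 1..n. (if k = i then ?R Q' i j $$ (x, y) else 0)
      + (if k = i - 1 then (E' (i - 1) * ?R Q' (i - 1) j) $$ (x, y) else 0))"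
    by (rule sum.cong[OF refl])
      (use Rc(2)[OF _ j] Q(2)[of j] j xy in \<open>auto simp: left_mult_one_mat[of _ p p] left_mult_zero_mat[of _ p p]\<close>)
  also have "\<dots> = ?R Q' i j $$ (x, y) + (if 1 < i then (E' (i - 1) * ?R Q' (i - 1) j) $$ (x, y) else 0)"
    using i by (auto simp: sum.distrib)
  finally have 2: "(block_lower_bidiag n p E' * block_upper_bidiag n p Q') $$ (a, b) = \<dots>" .
  consider "j = i" | "j = i + 1" | "i = j + 1" | "j \<noteq> i" "j \<noteq> i + 1" "i \<noteq> j + 1" by blast
  then have "(Q i * ?L E i j) $$ (x, y) + (if i < n then ?L E (i + 1) j $$ (x, y) else 0)
    = ?R Q' i j $$ (x, y) + (if 1 < i then (E' (i - 1) * ?R Q' (i - 1) j) $$ (x, y) else 0)"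
  proof cases
    case 1
    have c: "Q i \<in> carrier_mat p p" "Q' i \<in> carrier_mat p p" "E i \<in> carrier_mat p p" "E' (i - 1) \<in> carrier_mat p p"
      using Q E i by auto
    have "(Q' i + E' (i - 1)) $$ (x, y) = (Q i + E i) $$ (x, y)" using diag[OF i] by simp
    then have "Q' i $$ (x, y) + E' (i - 1) $$ (x, y) = Q i $$ (x, y) + E i $$ (x, y)"
      using c xy by simp
    moreover have "E i $$ (x, y) = 0" if "\<not> i < n"
    proof -
      have "i = n" using that i by simp
      then show ?thesis using bd xy by simp
    qed
    moreover have "E' (i - 1) $$ (x, y) = 0" if "\<not> 1 < i"
    proof -
      have "i = 1" using that i by simp
      then show ?thesis using bd xy by simp
    qed
    ultimately show ?thesis using 1 c i xy
      by (auto simp: right_mult_one_mat[of _ p p])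
  next
    case 2
    have c: "Q i \<in> carrier_mat p p" "E' (i - 1) \<in> carrier_mat p p" using Q E i by auto
    show ?thesis using 2 c i j xy by (auto simp: right_mult_zero_mat[of _ p p])
  next
    case 3
    then show ?thesis using sub[of j] i j xy by auto
  next
    case 4
    have c: "Q i \<in> carrier_mat p p" "E' (i - 1) \<in> carrier_mat p p" using Q E i by auto
    show ?thesis using 4 c i j xy by (auto simp: right_mult_zero_mat[of _ p p])
  qed
  then show "(block_upper_bidiag n p Q * block_lower_bidiag n p E) $$ (a, b)
    = (block_lower_bidiag n p E' * block_upper_bidiag n p Q') $$ (a, b)"
    using 1 2 by simp
qed (auto simp: block_lower_bidiag_def block_upper_bidiag_def block_matrix_def)

lemma unit_block_lower_block_lower_bidiag: "unit_block_lower n p (block_lower_bidiag n p E)"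
proof (rule unit_block_lowerI)
  fix a b assume ab: "a < n * p" "b < n * p" "a div p \<le> b div p"
  then have p: "p > 0" by (cases p) auto
  have "a = b \<longleftrightarrow> a div p = b div p \<and> a mod p = b mod p"
    by (metis div_mod_decomp)
  then show "block_lower_bidiag n p E $$ (a, b) = (if a = b then 1 else 0)"
    using ab p by (auto simp: block_lower_bidiag_def block_matrix_def)
qed (simp add: block_lower_bidiag_def block_matrix_def)

lemma block_upper_block_upper_bidiag: "block_upper n p (block_upper_bidiag n p Q)"
  unfolding block_upper_def
proof (intro conjI allI impI)
  fix a b assume ab: "a < n * p" "b < n * p" "b div p < a div p"
  then have p: "p > 0" by (cases p) auto
  then show "block_upper_bidiag n p Q $$ (a, b) = 0"
    using ab by (auto simp: block_upper_bidiag_def block_matrix_def)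
qed (simp add: block_upper_bidiag_def block_matrix_def)

text \<open>Induction peels off the last diagonal block: the blocks to its left are 0, so the minor
  gains the factor \<open>det (Q (Suc k))\<close>.\<close>

lemma leading_block_minor_block_upper_bidiag_nonzero:
  fixes Q :: "nat \<Rightarrow> 'a :: idom mat"
  assumes Q: "\<And>m. m \<in> {1..k} \<Longrightarrow> Q m \<in> carrier_mat p p \<and> det (Q m) \<noteq> 0" and "k \<le> n"
  shows "leading_block_minor p k (block_upper_bidiag n p Q) \<noteq> 0"
  using assms
proof (induction k)
  case 0
  then show ?case by (simp add: leading_block_minor_def)
next
  case (Suc k)
  let ?R = "block_upper_bidiag n p Q"
  let ?B = "mat (k * p) p (\<lambda>(a, b). ?R $$ (a, b + k * p))"
  have Qc: "Q (Suc k) \<in> carrier_mat p p" "det (Q (Suc k)) \<noteq> 0" using Suc.prems(1)[of "Suc k"] by auto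
  have le: "p + k * p \<le> n * p" using mult_le_mono1[OF Suc.prems(2), of p] by simp
  have "leading_submat (Suc k * p) ?R
      = four_block_mat (leading_submat (k * p) ?R) ?B (0\<^sub>m p (k * p)) (Q (Suc k))" (is "?A = ?F")
  proof (rule eq_matI)
    fix a b assume "a < dim_row ?F" "b < dim_col ?F"
    then have ab: "a < p + k * p" "b < p + k * p" using Qc by auto
    then have ab': "a < n * p" "b < n * p" using le by linarith+
    have p: "p > 0" using ab by (cases p) auto
    show "?A $$ (a, b) = ?F $$ (a, b)"
    proof (cases "a < k * p")
      case True
      then show ?thesis using ab Qc by auto
    next
      case False
      then obtain x where x: "a = k * p + x" "x < p"
        using ab by (metis add.commute add_less_cancel_left le_Suc_ex not_less)
      show ?thesis
      proof (cases "b < k * p")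
        case True
        then have "b div p < a div p" using x p by (simp add: div_less_iff_less_mult)
        then show ?thesis using True False ab Qc
          block_upperD(2)[OF block_upper_block_upper_bidiag ab'] by auto
      next
        case False
        then obtain y where y: "b = k * p + y" "y < p"
          using ab by (metis add.commute add_less_cancel_left le_Suc_ex not_less)
        show ?thesis using x y ab ab' Qc
          by (simp add: block_upper_bidiag_def block_matrix_def)
      qed
    qed
  qed (use Qc in auto)
  then have "det ?A = det (leading_submat (k * p) ?R) * det (Q (Suc k))"
    using Qc by (simp only:) (rule det_four_block_mat_lower_left_zero[of _ "k * p" _ p], auto)
  then show ?case
    using Suc Qc by (auto simp: leading_block_minor_def)
qed

lemma invertible_mat_imp_det_nonzero:
  fixes A :: "'a :: field mat"
  assumes "invertible_mat A"
  shows "det A \<noteq> 0"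
proof -
  from assms obtain B where sq: "square_mat A" and AB: "A * B = 1\<^sub>m (dim_row A)" and BA: "B * A = 1\<^sub>m (dim_row B)"
    unfolding invertible_mat_def inverts_mat_def by blast
  have "B \<in> carrier_mat (dim_row A) (dim_row A)" "A \<in> carrier_mat (dim_row A) (dim_row A)"
    using sq arg_cong[OF AB, of dim_col] arg_cong[OF BA, of dim_col] by auto
  from det_mult[OF this(2,1)] AB show ?thesis by auto
qed

subsection \<open>Block LR iteration\<close>

lemma leading_block_minor_mat_diag:
  fixes d :: "nat \<Rightarrow> 'a :: comm_ring_1"
  assumes "k \<le> n"
  shows "leading_block_minor p k (mat_diag (n * p) d) = (\<Prod>i<k*p. d i)"
proof -
  have "k * p \<le> n * p" using assms by simp
  then have le: "i < n * p" if "i < k * p" for i using that by linarith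
  let ?A = "leading_submat (k * p) (mat_diag (n * p) d)"
  have "det ?A = prod_list (diag_mat ?A)"
    by (rule det_upper_triangular[of _ "k * p"]) (use le in \<open>auto simp: mat_diag_def\<close>)
  also have "\<dots> = (\<Prod>i<k*p. d i)"
    unfolding prod_list_diag_prod using le by (intro prod.cong) (auto simp: mat_diag_def)
  finally show ?thesis unfolding leading_block_minor_def .
qed

lemma block_upper_mat_diag: "block_upper n p (mat_diag (n * p) d)"
  unfolding block_upper_def by (auto simp: mat_diag_def)

text \<open>The left side is the \<open>k\<close>-th power of \<open>J\<close>. In the induction
  step \<open>J * P k * V = P (Suc k) * (R k * V)\<close>, so \<open>V\<close> accumulates the
  product of the earlier \<open>R\<close>.\<close>

lemma LR_power_decomposition:
  fixes J :: "'a :: comm_ring_1 mat"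
  assumes J: "J = X * mat_diag (n * p) d * Y" and X: "X \<in> carrier_mat (n * p) (n * p)"
    and Y: "Y \<in> carrier_mat (n * p) (n * p)"
    and XY: "X * Y = 1\<^sub>m (n * p)" and YX: "Y * X = 1\<^sub>m (n * p)"
    and P: "\<And>k. P k \<in> carrier_mat (n * p) (n * p)" "P 0 = 1\<^sub>m (n * p)"
    and R: "\<And>k. block_upper n p (R k)" and JP: "\<And>k. J * P k = P (Suc k) * R k"
  shows "\<exists>V. block_upper n p V \<and> X * mat_diag (n * p) (\<lambda>i. d i ^ k) * Y = P k * V"
proof (induction k)
  case 0
  show ?case
    by (rule exI[of _ "1\<^sub>m (n * p)"])
      (use X XY P(2) block_upper_one in \<open>auto simp: right_mult_one_mat[of _ "n * p" "n * p"]\<close>)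
next
  case (Suc k)
  then obtain V where V: "block_upper n p V" "X * mat_diag (n * p) (\<lambda>i. d i ^ k) * Y = P k * V" by blast
  let ?N = "n * p"
  let ?D = "mat_diag ?N d" and ?Dk = "mat_diag ?N (\<lambda>i. d i ^ k)"
  have c: "?D \<in> carrier_mat ?N ?N" "?Dk \<in> carrier_mat ?N ?N" by auto
  note Rc = block_upperD(1)[OF R[of k]] and Vc = block_upperD(1)[OF V(1)]
  have "?Dk * Y = Y * (X * (?Dk * Y))"
    using assoc_mult_mat[OF Y X mult_carrier_mat[OF c(2) Y]] YX c Y
    by (simp add: left_mult_one_mat[of _ "?N" "?N"])
  also have "\<dots> = Y * (P k * V)" using V(2) assoc_mult_mat[OF X c(2) Y] by simp
  finally have DY: "?Dk * Y = Y * (P k * V)" .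
  have "X * mat_diag ?N (\<lambda>i. d i ^ Suc k) * Y = X * (?D * ?Dk) * Y" by simp
  also have "\<dots> = X * ?D * (?Dk * Y)"
    using assoc_mult_mat[OF X c] assoc_mult_mat[OF mult_carrier_mat[OF X c(1)] c(2) Y] by simp
  also have "\<dots> = X * ?D * Y * (P k * V)"
    unfolding DY
    by (rule assoc_mult_mat[OF mult_carrier_mat[OF X c(1)] Y mult_carrier_mat[OF P(1) Vc], symmetric])
  also have "\<dots> = J * P k * V"
    unfolding J using X c Y by (intro assoc_mult_mat[OF _ P(1) Vc, symmetric]) auto
  also have "\<dots> = P (Suc k) * (R k * V)"
    unfolding JP by (rule assoc_mult_mat[OF P(1) Rc Vc])
  finally show ?case using block_upper_mult[OF R V(1)] by blast
qed

text \<open>\<open>M k\<close> plays the role of \<open>L\<close> conjugated by the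
  \<open>k\<close>-th power of the diagonal matrix, without inverting eigenvalues. The case
  \<open>d a = d b\<close> is separate because for the eigenvalue 0 the quotient
  \<open>0 / 0 = 0\<close> would erase the entry for positive \<open>k\<close>.\<close>

lemma scaled_unit_block_lower:
  fixes L :: "'a :: real_normed_field mat" and d :: "nat \<Rightarrow> 'a"
  assumes L: "unit_block_lower n p L"
    and d: "\<And>a b. a < b \<Longrightarrow> b < n * p \<Longrightarrow> d a = d b \<or> norm (d b) < norm (d a)"
  defines "M \<equiv> \<lambda>k. mat (n * p) (n * p)
      (\<lambda>(a, b). if d a = d b then L $$ (a, b) else (d a / d b) ^ k * L $$ (a, b))"
  shows "M k * mat_diag (n * p) (\<lambda>i. d i ^ k) = mat_diag (n * p) (\<lambda>i. d i ^ k) * L"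
    and "mat_tendsto M (restrict_to_eigenblocks (mat_diag (n * p) d) L)"
proof -
  note Lc = unit_block_lowerD(1)[OF L]
  \<comment> \<open>A nonzero entry between different eigenvalues lies below the diagonal, so
    \<open>d b\<close> comes earlier and dominates. This makes \<open>d b\<close> nonzero and the
    quotient smaller than 1 in norm.\<close>
  have below: "norm (d a) < norm (d b)"
    if "a < n * p" "b < n * p" "d a \<noteq> d b" "L $$ (a, b) \<noteq> 0" for a b
  proof -
    have "\<not> a \<le> b"
    proof
      assume "a \<le> b"
      then have "L $$ (a, b) = (if a = b then 1 else 0)"
        using unit_block_lowerD(2)[OF L] that(1,2) div_le_mono by blast
      then show False using that(3,4) by (auto split: if_splits)
    qed
    then show ?thesis using d[of b a] that by auto
  qed
  show "M k * mat_diag (n * p) (\<lambda>i. d i ^ k) = mat_diag (n * p) (\<lambda>i. d i ^ k) * L"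
  proof -
    have Mc: "M k \<in> carrier_mat (n * p) (n * p)" unfolding M_def by simp
    show ?thesis
      unfolding mat_diag_mult_right[OF Mc] mat_diag_mult_left[OF Lc]
    proof (rule cong_mat)
      fix a b assume ab: "a < n * p" "b < n * p"
      show "(case (a, b) of (i, j) \<Rightarrow> M k $$ (i, j) * d j ^ k)
          = (case (a, b) of (i, j) \<Rightarrow> d i ^ k * L $$ (i, j))"
      proof (cases "d a = d b \<or> L $$ (a, b) = 0")
        case False
        then have "d b \<noteq> 0" using below[OF ab] by auto
        then show ?thesis using False ab by (simp add: M_def power_divide)
      qed (use ab in \<open>auto simp: M_def\<close>)
    qed auto
  qed
  show "mat_tendsto M (restrict_to_eigenblocks (mat_diag (n * p) d) L)"
  proof (rule mat_tendstoI[of _ "n * p" "n * p"])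
    fix a b assume ab: "a < n * p" "b < n * p"
    have "(\<lambda>k. if d a = d b then L $$ (a, b) else (d a / d b) ^ k * L $$ (a, b))
        \<longlonglongrightarrow> (if d a = d b then L $$ (a, b) else 0)"
    proof (cases "d a = d b \<or> L $$ (a, b) = 0")
      case False
      then have *: "norm (d a) < norm (d b)" using below[OF ab] by auto
      then have "0 < norm (d b)" using norm_ge_zero[of "d a"] by linarith
      then have "norm (d a / d b) < 1" using * by (simp add: norm_divide)
      then show ?thesis using False by (auto intro!: tendsto_mult_left_zero LIMSEQ_power_zero)
    qed auto
    then show "(\<lambda>k. M k $$ (a, b)) \<longlonglongrightarrow> restrict_to_eigenblocks (mat_diag (n * p) d) L $$ (a, b)"
      using ab Lc by (simp add: M_def restrict_to_eigenblocks_def mat_diag_def)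
  qed (use Lc in \<open>auto simp: M_def restrict_to_eigenblocks_def\<close>)
qed

text \<open>The eliminator \<open>N k\<close> of \<open>X * M k\<close> converges and eventually
  inverts \<open>P k\<close>. From then on \<open>K k = N k * J * P k\<close> and
  \<open>R k = N (Suc k) * J * P k\<close>, and the index shift does not affect the limit.\<close>

lemma LR_iteration_converges:
  fixes J :: "'a :: real_normed_field mat"
  assumes J: "J = X * mat_diag (n * p) d * Y" and X: "X \<in> carrier_mat (n * p) (n * p)"
    and Y: "Y \<in> carrier_mat (n * p) (n * p)"
    and XY: "X * Y = 1\<^sub>m (n * p)" and YX: "Y * X = 1\<^sub>m (n * p)"
    and P: "\<And>k. unit_block_lower n p (P k)" "P 0 = 1\<^sub>m (n * p)"
    and R: "\<And>k. block_upper n p (R k)" and JP: "\<And>k. J * P k = P (Suc k) * R k"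
    and K: "\<And>k. K k \<in> carrier_mat (n * p) (n * p)" and PK: "\<And>k. P k * K k = P (Suc k) * R k"
    and d: "\<And>a b. a < b \<Longrightarrow> b < n * p \<Longrightarrow> d a = d b \<or> norm (d b) < norm (d a)"
    and d0: "\<And>a. a < (n - 1) * p \<Longrightarrow> d a \<noteq> 0"
    and Ym: "leading_block_minors_nonzero n p Y"
    and XLm: "leading_block_minors_nonzero n p
      (X * restrict_to_eigenblocks (mat_diag (n * p) d) (block_LU_lower n p Y))"
  obtains G where "G \<in> carrier_mat (n * p) (n * p)" "mat_tendsto R G" "mat_tendsto K G"
proof -
  let ?N = "n * p"
  let ?D = "\<lambda>k. mat_diag ?N (\<lambda>i. d i ^ k)"
  define L where "L = block_LU_lower n p Y"
  have L: "unit_block_lower n p L" unfolding L_def by (rule block_LU_lower(1)[OF Y Ym])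
  obtain U where U: "block_upper n p U" "Y = L * U"
    using block_LU_lower(2)[OF Y Ym] unfolding L_def by blast
  define M where "M k = mat ?N ?N
      (\<lambda>(a, b). if d a = d b then L $$ (a, b) else (d a / d b) ^ k * L $$ (a, b))" for k :: nat
  have MD: "M k * ?D k = ?D k * L" for k
    unfolding M_def by (rule scaled_unit_block_lower(1)[OF L d])
  have M: "mat_tendsto M (restrict_to_eigenblocks (mat_diag ?N d) L)"
    unfolding M_def by (rule scaled_unit_block_lower(2)[OF L d])
  note Lc = unit_block_lowerD(1)[OF L] and Uc = block_upperD(1)[OF U(1)]
    and Pc = unit_block_lowerD(1)[OF P(1)] and Rc = block_upperD(1)[OF R]
  have Mc: "M k \<in> carrier_mat ?N ?N" for k unfolding M_def by simp
  have Dc: "?D k \<in> carrier_mat ?N ?N" for k by simp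
  have Jc: "J \<in> carrier_mat ?N ?N" unfolding J using X Y by (auto intro!: mult_carrier_mat)
  have rc: "restrict_to_eigenblocks (mat_diag ?N d) L \<in> carrier_mat ?N ?N"
    using Lc by (simp add: restrict_to_eigenblocks_def)
  define A where "A k = X * M k" for k
  define B where "B = X * restrict_to_eigenblocks (mat_diag ?N d) L"
  have Ac: "A k \<in> carrier_mat ?N ?N" for k unfolding A_def using X Mc by simp
  have Bc: "B \<in> carrier_mat ?N ?N" unfolding B_def using X rc by simp
  have AB: "mat_tendsto A B"
    unfolding A_def B_def by (rule mat_tendsto_mult[OF mat_tendsto_const M X rc])
  have Bm: "leading_block_minors_nonzero n p B" using XLm unfolding B_def L_def .
  define N where "N k = block_eliminator n p (A k)" for k
  define N' where "N' = block_eliminator n p B"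
  have N: "unit_block_lower n p (N k)" for k
    unfolding N_def by (rule unit_block_lower_block_eliminator)
  have N'c: "N' \<in> carrier_mat ?N ?N"
    unfolding N'_def by (rule unit_block_lowerD(1)[OF unit_block_lower_block_eliminator])
  note Nc = unit_block_lowerD(1)[OF N]
  have lim: "mat_tendsto N N'"
    unfolding N_def N'_def by (rule tendsto_block_eliminator[OF AB Bc Bm])
  \<comment> \<open>\<open>P k\<close> is compared with \<open>X * M k\<close> through two
    factorizations of the \<open>k\<close>-th power of \<open>J\<close>: \<open>P k * V\<close> and
    \<open>X * M k * (?D k * U)\<close>.\<close>
  have NP: "N k * P k = 1\<^sub>m ?N" if Am: "leading_block_minors_nonzero n p (A k)" for k
  proof -
    obtain V where V: "block_upper n p V" "X * ?D k * Y = P k * V"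
      using LR_power_decomposition[OF J X Y XY YX Pc P(2) R JP] by blast
    have "X * ?D k * Y = X * (?D k * L) * U"
      using assoc_mult_mat[OF mult_carrier_mat[OF X Dc] Lc Uc] assoc_mult_mat[OF X Dc Lc] U(2) by simp
    also have "\<dots> = A k * ?D k * U"
      unfolding A_def using assoc_mult_mat[OF X Mc Dc] MD by simp
    also have "\<dots> = A k * (?D k * U)" by (rule assoc_mult_mat[OF Ac Dc Uc])
    finally have "P k * V = A k * (?D k * U)" using V(2) by simp
    \<comment> \<open>Minors up to size \<open>n - 1\<close> involve only the first
      \<open>(n - 1) * p\<close> eigenvalues, all nonzero; later eigenvalues may be 0.\<close>
    moreover have "leading_block_minors_nonzero n p (?D k * U)"
      unfolding leading_block_minors_nonzero_def
    proof
      fix i assume i: "i \<in> {1..<n}"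
      have "leading_block_minor p i (?D k * U) = (\<Prod>a<i*p. d a ^ k) * leading_block_minor p i U"
        using leading_block_minor_mult_upper[OF Dc U(1), of i]
          leading_block_minor_mat_diag[of i n p "\<lambda>a. d a ^ k"] i by simp
      moreover have "leading_block_minor p i U = leading_block_minor p i Y"
        using leading_block_minor_mult_lower[OF Uc L] U(2) i by auto
      moreover have "d a \<noteq> 0" if "a < i * p" for a
      proof (rule d0)
        have "i * p \<le> (n - 1) * p" using i by (intro mult_le_mono1) auto
        then show "a < (n - 1) * p" using that by linarith
      qed
      ultimately show "leading_block_minor p i (?D k * U) \<noteq> 0"
        using Ym i unfolding leading_block_minors_nonzero_def by auto
    qed
    ultimately show ?thesis
      unfolding N_def
      using block_eliminator_mult_lower[OF Ac Am block_upper_mult[OF block_upper_mat_diag U(1)] _ P(1) V(1)]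
      by simp
  qed
  have ev: "\<forall>\<^sub>F k in sequentially. N k * P k = 1\<^sub>m ?N"
    using eventually_leading_block_minors_nonzero[OF AB Bc Bm] by eventually_elim (rule NP)
  \<comment> \<open>As \<open>det (N k) = 1\<close>, the adjugate is the inverse of
    \<open>N k\<close>; this transfers convergence from \<open>N\<close> to
    \<open>P\<close>.\<close>
  have adj: "adj_mat (N k) = P k" if "N k * P k = 1\<^sub>m ?N" for k
  proof -
    note ac = adj_mat(1)[OF Nc]
    have "adj_mat (N k) = adj_mat (N k) * (N k * P k)"
      using that ac by (simp add: right_mult_one_mat[of _ ?N ?N])
    also have "\<dots> = adj_mat (N k) * N k * P k" by (rule assoc_mult_mat[OF ac Nc Pc, symmetric])
    also have "adj_mat (N k) * N k = 1\<^sub>m ?N"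
      using adj_mat(3)[OF Nc] det_unit_block_lower[OF N] by auto
    also have "1\<^sub>m ?N * P k = P k" by (rule left_mult_one_mat[OF Pc])
    finally show ?thesis .
  qed
  define G where "G = N' * J * adj_mat N'"
  have N'J: "N' * J \<in> carrier_mat ?N ?N" using N'c Jc by simp
  have Gc: "G \<in> carrier_mat ?N ?N" unfolding G_def using N'J adj_mat(1)[OF N'c] by simp
  have N'J_lim: "mat_tendsto (\<lambda>k. N k * J) (N' * J)"
    by (rule mat_tendsto_mult[OF lim mat_tendsto_const N'c Jc])
  have adj_lim: "mat_tendsto (\<lambda>k. adj_mat (N k)) (adj_mat N')"
    by (rule tendsto_adj_mat[OF lim N'c])
  have "mat_tendsto (\<lambda>k. N k * J * adj_mat (N k)) G"
    unfolding G_def by (rule mat_tendsto_mult[OF N'J_lim adj_lim N'J adj_mat(1)[OF N'c]])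
  then have KG: "mat_tendsto K G"
  proof (rule mat_tendsto_eventually_cong[OF _ Gc K])
    show "\<forall>\<^sub>F k in sequentially. N k * J * adj_mat (N k) = K k"
      using ev
    proof eventually_elim
      case (elim k)
      have "N k * J * P k = N k * (P k * K k)"
        unfolding PK using JP[of k] assoc_mult_mat[OF Nc Jc Pc] by simp
      also have "\<dots> = K k"
        using assoc_mult_mat[OF Nc Pc K, symmetric] elim K[of k] by (simp add: left_mult_one_mat[of _ ?N ?N])
      finally show ?case using adj[OF elim] by simp
    qed
  qed
  have "mat_tendsto (\<lambda>k. N (Suc k) * J * adj_mat (N k)) G"
    unfolding G_def
    by (rule mat_tendsto_mult[OF mat_tendsto_Suc[OF N'J_lim] adj_lim N'J adj_mat(1)[OF N'c]])
  then have RG: "mat_tendsto R G"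
  proof (rule mat_tendsto_eventually_cong[OF _ Gc Rc])
    show "\<forall>\<^sub>F k in sequentially. N (Suc k) * J * adj_mat (N k) = R k"
      using ev ev[THEN sequentially_offset, of 1]
    proof eventually_elim
      case (elim k)
      have "N (Suc k) * J * P k = N (Suc k) * (P (Suc k) * R k)"
        using JP[of k] assoc_mult_mat[OF Nc Jc Pc] by simp
      also have "\<dots> = R k"
        using assoc_mult_mat[OF Nc Pc Rc, symmetric] elim Rc[of k] by (simp add: left_mult_one_mat[of _ ?N ?N])
      finally show ?case using adj[OF elim(1)] by simp
    qed
  qed
  show thesis by (rule that[OF Gc RG KG])
qed

text \<open>Every term of the Leibniz expansion meets the zero rectangle: a permutation cannot send
  \<open>N - m + 1\<close> rows injectively into the remaining \<open>N - m\<close> columns.\<close>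

lemma det_zero_of_zero_corner:
  fixes Y :: "'a :: comm_ring_1 mat"
  assumes Y: "Y \<in> carrier_mat N N" and m: "0 < m" "m \<le> N"
    and zero: "\<And>i j. m - 1 \<le> i \<Longrightarrow> i < N \<Longrightarrow> j < m \<Longrightarrow> Y $$ (i, j) = 0"
  shows "det Y = 0"
  unfolding det_def'[OF Y]
proof (rule sum.neutral, rule ballI)
  fix \<pi> assume "\<pi> \<in> {\<pi>. \<pi> permutes {0..<N}}"
  then have \<pi>: "\<pi> permutes {0..<N}" by simp
  have "\<exists>i\<in>{m-1..<N}. \<pi> i < m"
  proof (rule ccontr)
    assume "\<not> ?thesis"
    then have "\<pi> ` {m-1..<N} \<subseteq> {m..<N}"
      using permutes_in_image[OF \<pi>] by (auto simp: not_less)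
    then have "card (\<pi> ` {m-1..<N}) \<le> card {m..<N}" by (intro card_mono) auto
    also have "card (\<pi> ` {m-1..<N}) = card {m-1..<N}"
      by (rule card_image[OF inj_on_subset[OF permutes_inj[OF \<pi>]]]) simp
    finally show False using m by simp
  qed
  then obtain i where "i \<in> {m-1..<N}" "\<pi> i < m" by blast
  then have "(\<Prod>i = 0..<N. Y $$ (i, \<pi> i)) = 0"
    using zero by (intro prod_zero bexI[of _ i]) auto
  then show "signof \<pi> * (\<Prod>i = 0..<N. Y $$ (i, \<pi> i)) = 0" by simp
qed

text \<open>At least \<open>(n - 1) * p\<close> eigenvalues are nonzero because \<open>R\<close> has rank at least \<open>(n - 1) * p\<close>.\<close>

lemma eigenvalue_nonzero_of_LR_step:
  fixes X :: "'a :: real_normed_field mat"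
  assumes X: "X \<in> carrier_mat (n * p) (n * p)"
    and Y: "Y \<in> carrier_mat (n * p) (n * p)"
    and XY: "X * Y = 1\<^sub>m (n * p)" and YX: "Y * X = 1\<^sub>m (n * p)"
    and P: "unit_block_lower n p P" and Q: "Q \<in> carrier_mat (n * p) (n * p)"
    and R: "block_upper n p R"
    and eq: "X * mat_diag (n * p) d * Y * Q = P * R"
    and minor: "leading_block_minor p (n - 1) R \<noteq> 0"
    and d: "\<And>a b. a < b \<Longrightarrow> b < n * p \<Longrightarrow> d a = d b \<or> norm (d b) < norm (d a)"
    and a: "a < (n - 1) * p"
  shows "d a \<noteq> 0"
proof
  assume da: "d a = 0"
  let ?N = "n * p" and ?D = "mat_diag (n * p) d"
  define m where "m = (n - 1) * p"
  have m: "0 < m" "m \<le> ?N" using a unfolding m_def by (linarith, simp)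
  note Pc = unit_block_lowerD(1)[OF P] and Rc = block_upperD(1)[OF R]
  have Dc: "?D \<in> carrier_mat ?N ?N" by simp
  have YQ: "Y * Q \<in> carrier_mat ?N ?N" and DYQ: "?D * (Y * Q) \<in> carrier_mat ?N ?N"
    using mult_carrier_mat[OF Y Q] mult_carrier_mat[OF Dc mult_carrier_mat[OF Y Q]] by blast+
  have Zc: "Y * P \<in> carrier_mat ?N ?N" using Y Pc by simp
  \<comment> \<open>Multiplication by \<open>Y\<close> leaves a diagonal matrix in front, so a zero
    eigenvalue annihilates the corresponding row of \<open>Y * P * R\<close>.\<close>
  have "Y * P * R = Y * (X * ?D * Y * Q)" unfolding eq by (rule assoc_mult_mat[OF Y Pc Rc])
  also have "X * ?D * Y * Q = X * (?D * (Y * Q))"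
    using assoc_mult_mat[OF mult_carrier_mat[OF X Dc] Y Q] assoc_mult_mat[OF X Dc YQ] by simp
  also have "Y * (X * (?D * (Y * Q))) = ?D * (Y * Q)"
    using assoc_mult_mat[OF Y X DYQ] YX DYQ by (simp add: left_mult_one_mat[of _ ?N ?N])
  finally have ZR: "Y * P * R = ?D * (Y * Q)" .
  \<comment> \<open>The first \<open>m\<close> entries of row \<open>b\<close> lie in the left
    kernel of the nonsingular leading part of \<open>R\<close>. Starting at row \<open>m - 1\<close>
    rather than \<open>m\<close> gives the one extra row that forces the determinant to
    vanish.\<close>
  have zero: "(Y * P) $$ (b, c) = 0" if b: "m - 1 \<le> b" "b < ?N" and c: "c < m" for b c
  proof (rule left_kernel_leading_block[OF minor, of "\<lambda>c. (Y * P) $$ (b, c)"])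
    show "c < (n - 1) * p" using c unfolding m_def .
    fix j assume j: "j < (n - 1) * p"
    then have p: "p > 0" by (cases p) auto
    have j': "j < ?N" "j div p < n - 1"
      using j m p by (auto simp: m_def div_less_iff_less_mult intro: less_le_trans)
    \<comment> \<open>Here \<open>a \<le> m - 1 \<le> b\<close>, and no eigenvalue after position
      \<open>a\<close> can have modulus larger than 0.\<close>
    have db: "d b = 0"
    proof (cases "a = b")
      case False
      then have "a < b" using a b by (simp add: m_def)
      then show ?thesis using d[of a b] b da by auto
    qed (use da in simp)
    have "(Y * P) $$ (b, c) * R $$ (c, j) = 0" if "c \<in> {..<?N} - {..<(n - 1) * p}" for c
    proof -
      have "n - 1 \<le> c div p" using that p by (auto simp: less_eq_div_iff_mult_less_eq)
      then show ?thesis using block_upperD(2)[OF R _ j'(1), of c] j' that by auto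
    qed
    then have "(\<Sum>c<(n-1)*p. (Y * P) $$ (b, c) * R $$ (c, j)) = (\<Sum>c<?N. (Y * P) $$ (b, c) * R $$ (c, j))"
      using m by (intro sum.mono_neutral_left) (auto simp: m_def)
    also have "\<dots> = (Y * P * R) $$ (b, j)" by (rule mult_mat_entry[OF Zc Rc b(2) j'(1), symmetric])
    also have "\<dots> = 0" unfolding ZR mat_diag_mult_left[OF YQ] using b j' db by simp
    finally show "(\<Sum>c<(n-1)*p. (Y * P) $$ (b, c) * R $$ (c, j)) = 0" .
  qed
  have "det (Y * P) = 0" by (rule det_zero_of_zero_corner[OF Zc m zero])
  then have "det Y = 0" using det_mult[OF Y Pc] det_unit_block_lower[OF P] by simp
  then show False using det_mult[OF X Y] XY by simp
qed

subsection \<open>The qd lattice\<close>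

lemma unit_block_lower_of_real:
  assumes "unit_block_lower n p L"
  shows "unit_block_lower n p (map_mat of_real L :: 'a :: real_algebra_1 mat)"
  using assms unfolding unit_block_lower_def by auto

lemma block_upper_of_real:
  assumes "block_upper n p U"
  shows "block_upper n p (map_mat of_real U :: 'a :: real_algebra_1 mat)"
  using assms unfolding block_upper_def by auto

lemma leading_block_minor_of_real:
  assumes A: "A \<in> carrier_mat (n * p) (n * p)" and "k \<le> n"
  shows "leading_block_minor p k (map_mat complex_of_real A) = of_real (leading_block_minor p k A)"
proof -
  have "k * p \<le> n * p" using assms by simp
  then have "i < n * p" if "i < k * p" for i using that by linarith
  then have "leading_submat (k * p) (map_mat complex_of_real A)
      = map_mat complex_of_real (leading_submat (k * p) A)"
    using A by (intro eq_matI) auto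
  then show ?thesis unfolding leading_block_minor_def by simp
qed

text \<open>Induction over the eigenvalue runs: each appended run is constant with modulus strictly
  below that of all earlier ones, so the list is sorted with respect to being equal or strictly
  smaller in modulus.\<close>

lemma repeated_diag_decreasing:
  assumes "(\<Sum>i = 1..s. eta i) = N" and dec: "\<forall>i\<in>{1..<s}. cmod (lam i) > cmod (lam (i + 1))"
  obtains d where "repeated_diag s lam eta = mat_diag N d"
    "\<And>a b. a < b \<Longrightarrow> b < N \<Longrightarrow> d a = d b \<or> cmod (d b) < cmod (d a)"
proof -
  let ?ls = "\<lambda>s. concat (map (\<lambda>i. replicate (eta i) (lam i)) [1..<s + 1])"
  have len: "length (?ls t) = (\<Sum>i = 1..t. eta i)" for t
    by (induction t) auto
  have mono: "cmod (lam j) < cmod (lam i)" if "1 \<le> i" "i < j" "j \<le> s" for i j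
    using that(2,3)
  proof (induction j)
    case (Suc j)
    have "cmod (lam (Suc j)) < cmod (lam j)" using dec Suc.prems that(1) by auto
    moreover have "i = j \<or> cmod (lam j) < cmod (lam i)"
      using Suc.IH Suc.prems by (cases "i = j") auto
    ultimately show ?case by auto
  qed simp
  have "sorted_wrt (\<lambda>x y. x = y \<or> cmod y < cmod x) (?ls t)" if "t \<le> s" for t
    using that
  proof (induction t)
    case (Suc t)
    have "?ls (Suc t) = ?ls t @ replicate (eta (Suc t)) (lam (Suc t))" by simp
    moreover have "sorted_wrt (\<lambda>x y. x = y \<or> cmod y < cmod x) (replicate k (lam (Suc t)))" for k
      by (induction k) auto
    ultimately show ?case
      using Suc mono by (auto simp: sorted_wrt_append)
  qed simp
  from this[of s] have sorted: "sorted_wrt (\<lambda>x y. x = y \<or> cmod y < cmod x) (?ls s)" by simp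
  show thesis
  proof (rule that)
    show "repeated_diag s lam eta = mat_diag N ((!) (?ls s))"
      unfolding repeated_diag_def Let_def len assms(1) ..
    show "?ls s ! a = ?ls s ! b \<or> cmod (?ls s ! b) < cmod (?ls s ! a)" if "a < b" "b < N" for a b
      using sorted_wrt_nth_less[OF sorted that(1)] that(2) unfolding len assms(1) by blast
  qed
qed

section \<open>Accumulated products of the lower factors\<close>

primrec qd_P :: "nat \<Rightarrow> nat \<Rightarrow> (nat \<Rightarrow> nat \<Rightarrow> real mat) \<Rightarrow> nat \<Rightarrow> real mat" where
  "qd_P n p e 0 = 1\<^sub>m (n * p)"
| "qd_P n p e (Suc \<alpha>) = qd_P n p e \<alpha> * qd_L n p e \<alpha>"

lemma unit_block_lower_qd_L: "unit_block_lower n p (qd_L n p e \<alpha>)"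
  unfolding qd_L_def by (rule unit_block_lower_block_lower_bidiag)

lemma block_upper_qd_R: "block_upper n p (qd_R n p q \<alpha>)"
  unfolding qd_R_def by (rule block_upper_block_upper_bidiag)

lemma unit_block_lower_qd_P: "unit_block_lower n p (qd_P n p e \<alpha>)"
  by (induction \<alpha>) (auto intro: unit_block_lower_one unit_block_lower_mult unit_block_lower_qd_L)

text \<open>Induction on \<open>m\<close> with \<open>M\<close> arbitrary: the last factor of the
  interval is absorbed into the start matrix.\<close>

lemma qd_P_foldr:
  assumes M: "M \<in> carrier_mat (n * p) (n * p)"
  shows "foldr (\<lambda>k M. qd_L n p e k * M) [\<alpha>..<\<alpha> + m] M \<in> carrier_mat (n * p) (n * p) \<and>
    qd_P n p e \<alpha> * foldr (\<lambda>k M. qd_L n p e k * M) [\<alpha>..<\<alpha> + m] M = qd_P n p e (\<alpha> + m) * M"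
  using M
proof (induction m arbitrary: M)
  case (Suc m)
  note Lc = unit_block_lowerD(1)[OF unit_block_lower_qd_L[of n p e "\<alpha> + m"]]
  have "qd_L n p e (\<alpha> + m) * M \<in> carrier_mat (n * p) (n * p)" using Lc Suc.prems by simp
  from Suc.IH[OF this] show ?case
    using assoc_mult_mat[OF unit_block_lowerD(1)[OF unit_block_lower_qd_P] Lc Suc.prems] by simp
qed simp

lemma qd_J_carrier: "qd_J n p \<theta> q e \<alpha> \<in> carrier_mat (n * p) (n * p)"
  and qd_P_J: "qd_P n p e \<alpha> * qd_J n p \<theta> q e \<alpha> = qd_P n p e (\<alpha> + \<theta>) * qd_R n p q \<alpha>"
  using qd_P_foldr[OF block_upperD(1)[OF block_upper_qd_R]] unfolding qd_J_def by blast+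

lemma qd_R_L:
  assumes "block_qd n p \<theta> q e"
  shows "qd_R n p q \<alpha> * qd_L n p e \<alpha> = qd_L n p e (\<alpha> + \<theta>) * qd_R n p q (\<alpha> + 1)"
  using assms unfolding block_qd_def qd_R_def qd_L_def
  by (intro block_upper_bidiag_mult_lower_bidiag) auto

text \<open>The appended factor \<open>qd_L n p e \<alpha>\<close> moves across
  \<open>qd_R n p q \<alpha>\<close> by the lattice identity and emerges with index
  \<open>\<alpha> + \<theta>\<close>, exactly the next factor of
  \<open>qd_P n p e (\<alpha> + \<theta>)\<close>.\<close>

lemma qd_J_P:
  assumes "block_qd n p \<theta> q e"
  shows "qd_J n p \<theta> q e 0 * qd_P n p e \<alpha> = qd_P n p e (\<alpha> + \<theta>) * qd_R n p q \<alpha>"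
proof (induction \<alpha>)
  case 0
  show ?case using qd_P_J[of n p e 0 \<theta> q] qd_J_carrier[of n p \<theta> q e 0]
    by (simp add: left_mult_one_mat[of _ "n * p" "n * p"] right_mult_one_mat[of _ "n * p" "n * p"])
next
  case (Suc \<alpha>)
  note Lc = unit_block_lowerD(1)[OF unit_block_lower_qd_L]
    and Pc = unit_block_lowerD(1)[OF unit_block_lower_qd_P] and Rc = block_upperD(1)[OF block_upper_qd_R]
  show ?case
    using assoc_mult_mat[OF qd_J_carrier Pc Lc, of n p \<theta> q e 0 e \<alpha> e \<alpha>] Suc.IH
      assoc_mult_mat[OF Pc Rc Lc, of n p e "\<alpha> + \<theta>" q \<alpha> e \<alpha>] qd_R_L[OF assms, of \<alpha>]
      assoc_mult_mat[OF Pc Lc Rc, of n p e "\<alpha> + \<theta>" e "\<alpha> + \<theta>" q "\<alpha> + 1"]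
    by simp
qed

text \<open>All blocks off the diagonal are independent of \<open>k\<close>, so the limit of the
  bidiagonal matrices is bidiagonal with the limit blocks, and uniqueness of limits passes this form
  to \<open>K\<close>. Real parts turn the complex limit \<open>G\<close> into a real one.\<close>

lemma block_upper_bidiag_limit:
  assumes Q: "\<And>k m. m \<in> {1..n} \<Longrightarrow> Q k m \<in> carrier_mat p p"
    and R: "mat_tendsto (\<lambda>k. map_mat complex_of_real (block_upper_bidiag n p (Q k))) G"
    and G: "G \<in> carrier_mat (n * p) (n * p)"
    and K: "mat_tendsto (\<lambda>k. map_mat complex_of_real (K k)) G"
    and Kc: "\<And>k. K k \<in> carrier_mat (n * p) (n * p)"
  shows "\<exists>Q_inf. (\<forall>m\<in>{1..n}. Q_inf m \<in> carrier_mat p p \<and> mat_tendsto (\<lambda>k. Q k m) (Q_inf m)) \<and>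
    mat_tendsto K (block_upper_bidiag n p Q_inf)"
proof -
  let ?R = "\<lambda>k. block_upper_bidiag n p (Q k)"
  have Rc: "?R k \<in> carrier_mat (n * p) (n * p)" for k
    by (rule block_upperD(1)[OF block_upper_block_upper_bidiag])
  have lim: "(\<lambda>k. A k $$ (a, b)) \<longlonglongrightarrow> Re (G $$ (a, b))"
    if "mat_tendsto (\<lambda>k. map_mat complex_of_real (A k)) G" "\<And>k. A k \<in> carrier_mat (n * p) (n * p)"
      "a < n * p" "b < n * p" for A a b
    using tendsto_Re[OF mat_tendstoD(2)[OF that(1) G that(3,4)]] that(3,4) carrier_matD[OF that(2)] by simp
  \<comment> \<open>The limit blocks are read off the diagonal of \<open>G\<close>; the offset
    \<open>m - 1\<close> reconciles blocks numbered from 1 with entries numbered from 0.\<close>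
  define Q_inf where "Q_inf m = mat p p (\<lambda>(x, y). Re (G $$ ((m - 1) * p + x, (m - 1) * p + y)))" for m
  have Q_lim: "mat_tendsto (\<lambda>k. Q k m) (Q_inf m)" if m: "m \<in> {1..n}" for m
  proof (rule mat_tendstoI[of _ p p])
    fix x y assume xy: "x < p" "y < p"
    obtain l where l: "m = Suc l" "l < n" using m by (cases m) auto
    have "l * p + p \<le> n * p" using mult_le_mono1[of "Suc l" n p] l by simp
    then have idx: "l * p + x < n * p" "l * p + y < n * p" using xy by linarith+
    show "(\<lambda>k. Q k m $$ (x, y)) \<longlonglongrightarrow> Q_inf m $$ (x, y)"
      using lim[OF R Rc idx] idx xy
      by (simp add: Q_inf_def l block_upper_bidiag_def block_matrix_def)
  qed (use Q m in \<open>auto simp: Q_inf_def\<close>)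
  have "mat_tendsto K (block_upper_bidiag n p Q_inf)"
  proof (rule mat_tendstoI[OF block_upperD(1)[OF block_upper_block_upper_bidiag] Kc])
    fix a b assume ab: "a < n * p" "b < n * p"
    then have p: "p > 0" by (cases p) auto
    then have i: "a div p + 1 \<in> {1..n}"
      using ab div_less_iff_less_mult[OF p, of a n] by auto
    have "Q_inf m \<in> carrier_mat p p" for m unfolding Q_inf_def by simp
    then have "(\<lambda>k. ?R k $$ (a, b)) \<longlonglongrightarrow> block_upper_bidiag n p Q_inf $$ (a, b)"
      using ab p mat_tendstoD(2)[OF Q_lim[OF i], of p p "a mod p" "b mod p"]
      by (cases "a div p = b div p") (simp_all add: block_upper_bidiag_def block_matrix_def)
    then have "Re (G $$ (a, b)) = block_upper_bidiag n p Q_inf $$ (a, b)"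
      using lim[OF R Rc ab] LIMSEQ_unique by blast
    then show "(\<lambda>k. K k $$ (a, b)) \<longlonglongrightarrow> block_upper_bidiag n p Q_inf $$ (a, b)"
      using lim[OF K Kc ab] by simp
  qed
  then show ?thesis using Q_lim by (intro exI[of _ Q_inf]) (auto simp: Q_inf_def)
qed

theorem theorem4p3:
  fixes n p \<theta> s :: nat
    and q e :: "nat \<Rightarrow> nat \<Rightarrow> real mat"
    and lam :: "nat \<Rightarrow> complex" and eta :: "nat \<Rightarrow> nat"
    and D X X_inv :: "complex mat"
  assumes "n > 0" and "p > 0" and "\<theta> > 0"
    and qd: "block_qd n p \<theta> q e"
    and carried_out: "\<forall>\<alpha>. \<forall>m\<in>{1..<n}. invertible_mat (q m (\<alpha> + 1))"
    and eigenvalues: "spectrum (map_mat complex_of_real (qd_J n p \<theta> q e 0)) = lam ` {1..s}"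
    and multiplicities: "\<forall>i\<in>{1..s}.
      Polynomial.order (lam i) (char_poly (map_mat complex_of_real (qd_J n p \<theta> q e 0))) = eta i"
    and "s < n * p"
    and "(\<Sum>i = 1..s. eta i) = n * p"
    and decreasing: "\<forall>i\<in>{1..<s}. cmod (lam i) > cmod (lam (i + 1))"
    and D: "D = repeated_diag s lam eta"
    and diagonalization:
      "similar_mat_wit (map_mat complex_of_real (qd_J n p \<theta> q e 0)) D X X_inv"
    and "leading_block_minors_nonzero n p X"
    and "leading_block_minors_nonzero n p X_inv"
    and "leading_block_minors_nonzero n p
      (X * restrict_to_eigenblocks D (block_LU_lower n p X_inv))"
  shows "\<exists>q_inf :: nat \<Rightarrow> real mat.
    (\<forall>m\<in>{1..n}. q_inf m \<in> carrier_mat p p \<and> mat_tendsto (\<lambda>\<alpha>. q m (\<theta> * \<alpha>)) (q_inf m)) \<and>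
    mat_tendsto (\<lambda>\<alpha>. qd_J n p \<theta> q e (\<theta> * \<alpha>)) (block_upper_bidiag n p q_inf)"
proof -
  let ?N = "n * p" and ?h = "map_mat complex_of_real"
  let ?J = "qd_J n p \<theta> q e" and ?P = "qd_P n p e" and ?R = "qd_R n p q"
  obtain d where Dd: "D = mat_diag ?N d"
    and d: "\<And>a b. a < b \<Longrightarrow> b < ?N \<Longrightarrow> d a = d b \<or> cmod (d b) < cmod (d a)"
    using repeated_diag_decreasing[OF \<open>(\<Sum>i = 1..s. eta i) = n * p\<close> decreasing] D by metis
  note Pc = unit_block_lowerD(1)[OF unit_block_lower_qd_P] and Rc = block_upperD(1)[OF block_upper_qd_R]
  have X: "X \<in> carrier_mat ?N ?N" "X_inv \<in> carrier_mat ?N ?N"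
    and XX: "X * X_inv = 1\<^sub>m ?N" "X_inv * X = 1\<^sub>m ?N"
    and J: "?h (?J 0) = X * mat_diag ?N d * X_inv"
    using diagonalization carrier_matD(1)[OF qd_J_carrier] Dd
    unfolding similar_mat_wit_def Let_def by auto
  have hJP: "?h (?J 0) * ?h (?P \<alpha>) = ?h (?P (\<alpha> + \<theta>)) * ?h (?R \<alpha>)" for \<alpha>
    unfolding of_real_hom.mat_hom_mult[OF qd_J_carrier Pc, symmetric]
      of_real_hom.mat_hom_mult[OF Pc Rc, symmetric] qd_J_P[OF qd] ..
  have hPJ: "?h (?P \<alpha>) * ?h (?J \<alpha>) = ?h (?P (\<alpha> + \<theta>)) * ?h (?R \<alpha>)" for \<alpha>
    unfolding of_real_hom.mat_hom_mult[OF Pc qd_J_carrier, symmetric]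
      of_real_hom.mat_hom_mult[OF Pc Rc, symmetric] qd_P_J ..
  \<comment> \<open>Invertibility is assumed for \<open>q m (\<alpha> + 1)\<close> with
    \<open>m < n\<close>, so the first usable factor is \<open>?R 1\<close>, and its minor stops at
    \<open>n - 1\<close> blocks.\<close>
  have "leading_block_minor p (n - 1) (?R 1) \<noteq> 0"
    unfolding qd_R_def
  proof (rule leading_block_minor_block_upper_bidiag_nonzero)
    fix m assume m: "m \<in> {1..n - 1}"
    have "invertible_mat (q m 1)" using carried_out[rule_format, of m 0] m by auto
    then show "q m 1 \<in> carrier_mat p p \<and> det (q m 1) \<noteq> 0"
      using qd m invertible_mat_imp_det_nonzero unfolding block_qd_def by auto
  qed simp
  then have minor: "leading_block_minor p (n - 1) (?h (?R 1)) \<noteq> 0"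
    using leading_block_minor_of_real[OF Rc, of "n - 1"] by simp
  have d0: "d a \<noteq> 0" if "a < (n - 1) * p" for a
    using eigenvalue_nonzero_of_LR_step[OF X XX unit_block_lower_of_real[OF unit_block_lower_qd_P] _
        block_upper_of_real[OF block_upper_qd_R] hJP[unfolded J] _ d that, of 1]
      minor Pc[of n p e 1] by (simp del: qd_P.simps)
  \<comment> \<open>Sampling at multiples of \<open>\<theta>\<close> turns the index shift by
    \<open>\<theta>\<close> into the successor step of an LR iteration.\<close>
  obtain G where "G \<in> carrier_mat ?N ?N" "mat_tendsto (\<lambda>k. ?h (?R (\<theta> * k))) G"
    "mat_tendsto (\<lambda>k. ?h (?J (\<theta> * k))) G"
  proof (rule LR_iteration_converges[OF J X XX, of "\<lambda>k. ?h (?P (\<theta> * k))"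
        "\<lambda>k. ?h (?R (\<theta> * k))" "\<lambda>k. ?h (?J (\<theta> * k))"])
    show "?h (?J 0) * ?h (?P (\<theta> * k)) = ?h (?P (\<theta> * Suc k)) * ?h (?R (\<theta> * k))" for k
      using hJP[of "\<theta> * k"] by (simp add: add.commute)
    show "?h (?P (\<theta> * k)) * ?h (?J (\<theta> * k)) = ?h (?P (\<theta> * Suc k)) * ?h (?R (\<theta> * k))" for k
      using hPJ[of "\<theta> * k"] by (simp add: add.commute)
    show "?h (?P (\<theta> * 0)) = 1\<^sub>m ?N" by (simp add: of_real_hom.mat_hom_one)
    show "leading_block_minors_nonzero n p
        (X * restrict_to_eigenblocks (mat_diag ?N d) (block_LU_lower n p X_inv))"
      using assms(15) Dd by simp
  qed (use d d0 assms(14) qd_J_carrier in \<open>auto intro: unit_block_lower_of_real unit_block_lower_qd_P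
      block_upper_of_real block_upper_qd_R\<close>)
  then show ?thesis
    using block_upper_bidiag_limit[of n "\<lambda>k m. q m (\<theta> * k)" p G "\<lambda>k. ?J (\<theta> * k)"]
      qd qd_J_carrier unfolding qd_R_def block_qd_def by auto
qed

end
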